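(* Let $T'$ be a uniformizer of $K$. Then any $x=(x_0,x_1,\ldots)\in W(K)$ has a unique representative in $W(K)/\wp W(K)$ of the form $$c\beta+\sum_{(i,p)=1}c_i[T'^{-i}]$$ with $c\in W(\mathbb F_p)$ and $c_i\in W(k)$ with $c_i\to0$ as $i\to\infty$. Furthermore, the following hold: (i) if $v(x_j)>0$ for all $j$, then $x\in\wp W(K)$; (ii) if $v(x_j)\ge0$ for all $j$, then $x\equiv c\beta\pmod{\wp W(K)}$; (iii) let $j$ be minimal such that $v(x_j)<0$, and assume $p\nmid v(x_j)$; then $\min_i v(c_i)=j$.
   Context: Let $k$ be a finite field of characteristic $p$ and $K=k((T))$ with its $T$-adic valuation $v$; a uniformizer is an element of valuation $1$. $W(\cdot)$ denotes $p$-typical Witt vectors, $F$ the Frobenius on Witt vectors, $\wp=F-\mathrm{id}$, $[a]=(a,0,0,\ldots)$ the Teichmüller lift. Fix $\alpha\in k$ with $\mathrm{Tr}_{k/\mathbb F_p}(\alpha)\neq0$ and set $\beta=[\alpha]\in W(k)\subset W(K)$. The sum runs over integers $i\ge1$ prime to $p$. On $W(k)$, $v$ denotes the $p$-adic valuation: $v(a_0,a_1,\ldots)$ is the least $i$ with $a_i\ne0$ ($\infty$ for $0$); convergence $c_i\to0$ is $p$-adic. *)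

theory Defs
  imports
    "HOL-Library.Poly_Mapping"
    "HOL-Library.Extended_Nat"
    "HOL-Library.Extended_Real"
    "HOL-Computational_Algebra.Formal_Laurent_Series"
    "HOL-Algebra.Ring"
begin

section \<open>The ring of \<open>p\<close>-typical Witt vectors\<close>

text \<open>
  Integer polynomials in two sequences of variables \<open>X\<^sub>0, X\<^sub>1, \<dots>\<close> and \<open>Y\<^sub>0, Y\<^sub>1, \<dots>\<close>:
  the index \<open>Inl i\<close> stands for \<open>X\<^sub>i\<close> and \<open>Inr i\<close> for \<open>Y\<^sub>i\<close>.
\<close>

type_synonym witt_poly = "((nat + nat) \<Rightarrow>\<^sub>0 nat) \<Rightarrow>\<^sub>0 int"

definition poly_var :: "nat + nat \<Rightarrow> witt_poly" where
  "poly_var v = Poly_Mapping.single (Poly_Mapping.single v 1) 1"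

definition poly_eval :: "(nat + nat \<Rightarrow> 'a::comm_ring_1) \<Rightarrow> witt_poly \<Rightarrow> 'a" where
  "poly_eval f P =
     (\<Sum>m\<in>Poly_Mapping.keys P.
        of_int (Poly_Mapping.lookup P m) *
        (\<Prod>v\<in>Poly_Mapping.keys m. f v ^ Poly_Mapping.lookup m v))"

definition ghost :: "nat \<Rightarrow> nat \<Rightarrow> (nat \<Rightarrow> 'a::comm_ring_1) \<Rightarrow> 'a" where
  "ghost p n z = (\<Sum>i\<le>n. of_nat p ^ i * z i ^ (p ^ (n - i)))"

text \<open>
  For a prime \<open>p\<close>, the families of integer polynomials below exist and are unique
  (Witt's theorem).
\<close>

definition witt_add_poly :: "nat \<Rightarrow> nat \<Rightarrow> witt_poly" where
  "witt_add_poly p =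
     (THE S. \<forall>n. ghost p n S =
        ghost p n (\<lambda>i. poly_var (Inl i)) + ghost p n (\<lambda>i. poly_var (Inr i)))"

definition witt_mult_poly :: "nat \<Rightarrow> nat \<Rightarrow> witt_poly" where
  "witt_mult_poly p =
     (THE P. \<forall>n. ghost p n P =
        ghost p n (\<lambda>i. poly_var (Inl i)) * ghost p n (\<lambda>i. poly_var (Inr i)))"

definition teich :: "'a::zero \<Rightarrow> nat \<Rightarrow> 'a" where
  "teich a = (\<lambda>n. if n = 0 then a else 0)"

definition witt_ring :: "nat \<Rightarrow> (nat \<Rightarrow> 'a::comm_ring_1) ring" where
  "witt_ring p =
     \<lparr>carrier = UNIV,
      mult = (\<lambda>x y n. poly_eval (case_sum x y) (witt_mult_poly p n)),
      one = teich 1,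
      zero = (\<lambda>_. 0),
      add = (\<lambda>x y n. poly_eval (case_sum x y) (witt_add_poly p n))\<rparr>"

text \<open>
  Over a ring of characteristic \<open>p\<close>, the Frobenius of Witt vectors is the map induced by
  functoriality from the \<open>p\<close>-power map, i.e. it acts componentwise.
\<close>

definition witt_frob :: "nat \<Rightarrow> (nat \<Rightarrow> 'a::comm_ring_1) \<Rightarrow> nat \<Rightarrow> 'a" where
  "witt_frob p x = (\<lambda>n. x n ^ p)"

definition wp :: "nat \<Rightarrow> (nat \<Rightarrow> 'a::comm_ring_1) \<Rightarrow> nat \<Rightarrow> 'a" where
  "wp p x = witt_frob p x \<ominus>\<^bsub>witt_ring p\<^esub> x"

definition witt_cong :: "nat \<Rightarrow> (nat \<Rightarrow> 'a::comm_ring_1) \<Rightarrow> (nat \<Rightarrow> 'a) \<Rightarrow> bool" where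
  "witt_cong p x y \<longleftrightarrow> x \<ominus>\<^bsub>witt_ring p\<^esub> y \<in> range (wp p)"

text \<open>The \<open>p\<close>-adic valuation on Witt vectors over a perfect field of characteristic \<open>p\<close>.\<close>

definition witt_val :: "(nat \<Rightarrow> 'a::zero) \<Rightarrow> enat" where
  "witt_val a = (if \<forall>i. a i = 0 then \<infinity> else enat (LEAST i. a i \<noteq> 0))"


section \<open>Laurent series and constants\<close>

definition fls_val :: "'a::zero fls \<Rightarrow> ereal" where
  "fls_val f = (if f = 0 then \<infinity> else ereal (of_int (fls_subdegree f)))"

text \<open>The inclusion of \<open>W(k)\<close> in \<open>W(k((T)))\<close>.\<close>

definition witt_const :: "(nat \<Rightarrow> 'a::zero) \<Rightarrow> nat \<Rightarrow> 'a fls" where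
  "witt_const c = (\<lambda>n. fls_const (c n))"

text \<open>In characteristic \<open>p\<close> this is the copy of \<open>F\<^sub>p\<close> inside the field.\<close>

definition prime_subfield :: "'a::ring_1 set" where
  "prime_subfield = range of_int"

definition galois_group :: "('a::field \<Rightarrow> 'a) set" where
  "galois_group =
     {\<sigma>. bij \<sigma> \<and> (\<forall>a b. \<sigma> (a + b) = \<sigma> a + \<sigma> b) \<and> (\<forall>a b. \<sigma> (a * b) = \<sigma> a * \<sigma> b) \<and>
         (\<forall>c\<in>prime_subfield. \<sigma> c = c)}"

text \<open>
  The trace of a finite field over its prime field (a Galois extension) as the sum of the
  Galois conjugates.
\<close>

definition field_trace :: "'a::{field,finite} \<Rightarrow> 'a" where
  "field_trace a = (\<Sum>\<sigma>\<in>galois_group. \<sigma> a)"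


section \<open>The representatives\<close>

definition prime_to :: "nat \<Rightarrow> nat set" where
  "prime_to p = {i. 1 \<le> i \<and> coprime i p}"

definition witt_null_family :: "nat \<Rightarrow> (nat \<Rightarrow> nat \<Rightarrow> 'a::zero) \<Rightarrow> bool" where
  "witt_null_family p cs \<longleftrightarrow>
     (\<forall>n::nat. \<exists>N. \<forall>i\<in>prime_to p. N \<le> i \<longrightarrow> enat n \<le> witt_val (cs i))"

text \<open>
  The family \<open>f\<close>, indexed by the positive integers prime to \<open>p\<close>, has sum \<open>s\<close> in the
  \<open>p\<close>-adic topology: for every \<open>n\<close>, all sufficiently late partial sums differ from \<open>s\<close> by
  an element of \<open>p\<^sup>n W\<close>.
\<close>

definition witt_sums ::
    "nat \<Rightarrow> (nat \<Rightarrow> nat \<Rightarrow> 'a::comm_ring_1) \<Rightarrow> (nat \<Rightarrow> 'a) \<Rightarrow> bool" where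
  "witt_sums p f s \<longleftrightarrow>
     (\<forall>n::nat. \<exists>N. \<forall>M\<ge>N.
        s \<ominus>\<^bsub>witt_ring p\<^esub> (\<Oplus>\<^bsub>witt_ring p\<^esub>i\<in>{i\<in>prime_to p. i < M}. f i)
          \<in> range (\<lambda>y. add_pow (witt_ring p) (p ^ n) y))"

text \<open>
  The pair \<open>(c, cs)\<close> is admissible data whose element
  \<open>c\<beta> + \<Sum>\<^sub>i cs\<^sub>i [T'\<^sup>-\<^sup>i]\<close>, with \<open>\<beta> = [\<alpha>]\<close>, represents the class of \<open>x\<close> modulo \<open>\<wp> W(K)\<close>.
  The values of \<open>cs\<close> at indices that do not occur in the sum are fixed by extensionality, so
  that \<open>cs\<close> is a family on \<^term>\<open>prime_to p\<close>.
\<close>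

definition represents ::
    "nat \<Rightarrow> 'a::field \<Rightarrow> 'a fls \<Rightarrow> (nat \<Rightarrow> 'a fls) \<Rightarrow> (nat \<Rightarrow> 'a) \<Rightarrow> (nat \<Rightarrow> nat \<Rightarrow> 'a) \<Rightarrow> bool"
  where
  "represents p \<alpha> T' x c cs \<longleftrightarrow>
     (\<forall>n. c n \<in> prime_subfield) \<and>
     cs \<in> extensional (prime_to p) \<and>
     witt_null_family p cs \<and>
     (\<exists>s. witt_sums p
            (\<lambda>i. witt_const (cs i) \<otimes>\<^bsub>witt_ring p\<^esub> teich (inverse (T' ^ i))) s \<and>
          witt_cong p x
            ((witt_const c \<otimes>\<^bsub>witt_ring p\<^esub> witt_const (teich \<alpha>)) \<oplus>\<^bsub>witt_ring p\<^esub> s))"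

end

theory Submission
  imports Defs
begin

text \<open>
  Reduction to components: since \<open>F V x = p x\<close>, one has \<open>V x \<equiv> p x\<close> modulo \<open>\<wp>\<close>, so a Witt vector
  is represented by treating its component \<open>0\<close> in the field and continuing \<open>p\<close>-adically.
  In \<open>k((T))\<close>, positive valuation implies membership in \<open>\<wp>\<close>, \<open>k = \<wp>(k) + F\<^sub>p \<alpha>\<close> by counting, and
  polar terms with exponent divisible by \<open>p\<close> can be replaced by their \<open>p\<close>-th roots. Conversely, a
  pole of \<open>y\<^sup>p - y\<close> has order divisible by \<open>p\<close>, and \<open>\<alpha> \<notin> \<wp>(k)\<close> by the trace. Hence the component
  \<open>0\<close> of all coefficients of a representative of \<open>0\<close> vanishes. Since \<open>W(K)/\<wp> W(K)\<close> has no
  \<open>p\<close>-torsion, one may divide by \<open>p\<close> and repeat.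
\<close>

section \<open>Integer polynomials\<close>

text \<open>The operations of \<open>witt_ring\<close> are definite descriptions, so nothing can be
  computed before Witt's theorem is available; Dwork's lemma supplies the polynomials. K is
  imperfect, and this shapes the argument: \<open>p ^ n W(K)\<close> is smaller than
  \<open>V ^ n W(K)\<close>, so cutting off leading components does not leave p-adic remainders.
  Only modulo \<wp> can V be exchanged for p, at the cost of a correction in the range. Extracting
  one digit therefore splits a vector into an admissible piece, an element of the range and p times
  a remainder, and each of the three series is summed p-adically. For (iii), the integral components
  before j contribute only a multiple of \<beta>. The rest is \<open>V ^ j Z\<close>, congruent to
  \<open>p ^ j Z\<close>, and uniqueness turns the claim into one about component 0 of the
  coefficients that represent Z.\<close>

locale comm_ring_hom =
  fixes h :: "'a::comm_ring_1 \<Rightarrow> 'b::comm_ring_1"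
  assumes hom_add: "h (a + b) = h a + h b"
    and hom_mult: "h (a * b) = h a * h b"
    and hom_one: "h 1 = 1"
begin

lemma hom_zero: "h 0 = 0"
  using hom_add[of 0 0] by simp

lemma hom_uminus: "h (- a) = - h a"
  using hom_add[of a "- a"] by (simp add: hom_zero eq_neg_iff_add_eq_0 add.commute)

lemma hom_diff: "h (a - b) = h a - h b"
  using hom_add[of a "- b"] by (simp add: hom_uminus)

lemma hom_power: "h (a ^ n) = h a ^ n"
  by (induction n) (simp_all add: hom_one hom_mult)

lemma hom_sum: "h (sum f A) = (\<Sum>a\<in>A. h (f a))"
  by (induction A rule: infinite_finite_induct) (simp_all add: hom_zero hom_add)

lemma hom_prod: "h (prod f A) = (\<Prod>a\<in>A. h (f a))"
  by (induction A rule: infinite_finite_induct) (simp_all add: hom_one hom_mult)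

lemma hom_of_nat: "h (of_nat n) = of_nat n"
  by (induction n) (simp_all add: hom_zero hom_one hom_add)

lemma hom_of_int: "h (of_int n) = of_int n"
  by (cases n) (simp_all add: hom_of_nat hom_uminus hom_diff hom_one)

lemma hom_ghost: "h (ghost p n x) = ghost p n (\<lambda>i. h (x i))"
  by (simp add: ghost_def hom_sum hom_mult hom_power hom_of_nat)

end

text \<open>The variables are arbitrary because, besides the two sequences of
  \<open>witt_poly\<close>, all elements of a given ring will serve as variables.\<close>

type_synonym 'v int_poly = "('v \<Rightarrow>\<^sub>0 nat) \<Rightarrow>\<^sub>0 int"

definition pvar :: "'v \<Rightarrow> 'v int_poly" where
  "pvar v = Poly_Mapping.single (Poly_Mapping.single v 1) 1"

definition monomial_eval :: "('v \<Rightarrow> 'a::comm_ring_1) \<Rightarrow> ('v \<Rightarrow>\<^sub>0 nat) \<Rightarrow> 'a" where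
  "monomial_eval f m = (\<Prod>v\<in>Poly_Mapping.keys m. f v ^ Poly_Mapping.lookup m v)"

definition peval :: "('v \<Rightarrow> 'a::comm_ring_1) \<Rightarrow> 'v int_poly \<Rightarrow> 'a" where
  "peval f P =
     (\<Sum>m\<in>Poly_Mapping.keys P. of_int (Poly_Mapping.lookup P m) * monomial_eval f m)"

lemma poly_eval_eq_peval: "poly_eval = peval"
  by (simp add: fun_eq_iff poly_eval_def peval_def monomial_eval_def)

lemma poly_var_eq_pvar: "poly_var = pvar"
  by (simp add: fun_eq_iff poly_var_def pvar_def)

lemma monomial_eval_superset:
  assumes "finite A" "Poly_Mapping.keys m \<subseteq> A"
  shows "monomial_eval f m = (\<Prod>v\<in>A. f v ^ Poly_Mapping.lookup m v)"
  unfolding monomial_eval_def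
  by (rule prod.mono_neutral_left) (use assms in \<open>auto simp: in_keys_iff\<close>)

lemma monomial_eval_0 [simp]: "monomial_eval f 0 = 1"
  by (simp add: monomial_eval_def)

lemma monomial_eval_add: "monomial_eval f (m + n) = monomial_eval f m * monomial_eval f n"
proof -
  let ?A = "Poly_Mapping.keys m \<union> Poly_Mapping.keys n"
  have "monomial_eval f (m + n) = (\<Prod>v\<in>?A. f v ^ Poly_Mapping.lookup (m + n) v)"
    by (rule monomial_eval_superset) (simp_all add: keys_add)
  also have "\<dots> = (\<Prod>v\<in>?A. f v ^ Poly_Mapping.lookup m v) * (\<Prod>v\<in>?A. f v ^ Poly_Mapping.lookup n v)"
    by (simp add: lookup_add power_add prod.distrib)
  also have "\<dots> = monomial_eval f m * monomial_eval f n"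
    by (subst (1 2) monomial_eval_superset[symmetric]) auto
  finally show ?thesis .
qed

lemma peval_single: "peval f (Poly_Mapping.single m c) = of_int c * monomial_eval f m"
  by (simp add: peval_def)

lemma peval_0: "peval f 0 = 0"
  by (simp add: peval_def)

lemma peval_add: "peval f (P + Q) = peval f P + peval f Q"
  unfolding peval_def
  by (rule setsum_keys_plus_distrib) (simp_all add: distrib_right)

lemma int_poly_additive_induct [case_names zero single add]:
  assumes "Q 0" and "\<And>m c. Q (Poly_Mapping.single m c)"
    and "\<And>f g. Q f \<Longrightarrow> Q g \<Longrightarrow> Q (f + g)"
  shows "Q (P :: 'v int_poly)"
proof (induction P rule: update_induct)
  case const
  show ?case by (rule assms(1))
next
  case (update f a b)
  then have "Poly_Mapping.update a b f = Poly_Mapping.single a b + f"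
    by (intro poly_mapping_eqI)
       (auto simp: lookup_update lookup_add lookup_single in_keys_iff when_def)
  then show ?case using update assms by simp
qed

lemma peval_mult: "peval f (P * Q) = peval f P * peval f Q"
proof (induction P rule: int_poly_additive_induct)
  case (single m c)
  show ?case
    by (induction Q rule: int_poly_additive_induct)
       (simp_all add: peval_0 peval_add peval_single mult_single monomial_eval_add algebra_simps)
qed (simp_all add: peval_0 peval_add algebra_simps)

lemma comm_ring_hom_peval: "comm_ring_hom (peval f)"
  by standard
     (simp_all add: peval_add peval_mult peval_single single_one[symmetric] del: single_one)

lemma peval_pvar [simp]: "peval f (pvar v) = f v"
  by (simp add: pvar_def peval_single monomial_eval_def)

lemma (in comm_ring_hom) hom_peval: "h (peval f P) = peval (\<lambda>v. h (f v)) P"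
  by (simp add: peval_def monomial_eval_def hom_sum hom_mult hom_of_int hom_prod hom_power)

lemma single_eq_prod_pvar:
  fixes m :: "'v \<Rightarrow>\<^sub>0 nat"
  shows "Poly_Mapping.single m (c::int) =
     of_int c * (\<Prod>v\<in>Poly_Mapping.keys m. pvar v ^ Poly_Mapping.lookup m v)"
proof -
  have "Poly_Mapping.single m (1::int) = (\<Prod>v\<in>Poly_Mapping.keys m. pvar v ^ Poly_Mapping.lookup m v)"
    for m :: "'v \<Rightarrow>\<^sub>0 nat"
  proof (induction m rule: update_induct)
    case const
    show ?case by simp
  next
    case (update m a b)
    have pow: "pvar a ^ n = Poly_Mapping.single (Poly_Mapping.single a n) 1" for n
      by (induction n) (simp_all add: pvar_def mult_single single_add[symmetric])
    have "Poly_Mapping.update a b m = Poly_Mapping.single a b + m"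
      using update
      by (intro poly_mapping_eqI)
         (auto simp: lookup_update lookup_add lookup_single in_keys_iff when_def)
    then have "Poly_Mapping.single (Poly_Mapping.update a b m) (1::int) =
        pvar a ^ b * Poly_Mapping.single m 1"
      by (simp add: pow mult_single)
    also have "\<dots> = pvar a ^ b * (\<Prod>v\<in>Poly_Mapping.keys m. pvar v ^ Poly_Mapping.lookup m v)"
      by (simp add: update.IH)
    also have "\<dots> = (\<Prod>v\<in>Poly_Mapping.keys (Poly_Mapping.update a b m).
        pvar v ^ Poly_Mapping.lookup (Poly_Mapping.update a b m) v)"
      using update by (auto simp: keys_update lookup_update intro!: arg_cong2[where f = "(*)"] prod.cong)
    finally show ?case .
  qed
  moreover have "Poly_Mapping.single m c = of_int c * Poly_Mapping.single m 1"
    by (simp add: mult_single flip: single_of_int)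
  ultimately show ?thesis by simp
qed

text \<open>Integer polynomials are generated as a ring by the variables. This form suits properties
  that respect ring operations but not the shape of monomials, such as the Frobenius
  congruence.\<close>

lemma int_poly_induct [case_names one uminus add mult pvar]:
  fixes P :: "'v int_poly"
  assumes one: "Q 1" and uminus: "\<And>f. Q f \<Longrightarrow> Q (- f)"
    and add: "\<And>f g. Q f \<Longrightarrow> Q g \<Longrightarrow> Q (f + g)"
    and mult: "\<And>f g. Q f \<Longrightarrow> Q g \<Longrightarrow> Q (f * g)"
    and pvar: "\<And>v. Q (pvar v)"
  shows "Q P"
proof -
  have zero: "Q 0"
    using add[OF one uminus[OF one]] by simp
  have nat: "Q (of_nat n)" for n
    by (induction n) (simp_all add: zero one add)
  then have int: "Q (of_int n)" for n
    by (cases n) (simp_all add: uminus[of "1 + of_nat _", simplified] add one)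
  have power: "Q f \<Longrightarrow> Q (f ^ n)" for f n
    by (induction n) (simp_all add: one mult)
  have prod: "(\<And>v. v \<in> A \<Longrightarrow> Q (g v)) \<Longrightarrow> Q (prod g A)" for g :: "'v \<Rightarrow> _" and A
    by (induction A rule: infinite_finite_induct) (simp_all add: one mult)
  show ?thesis
  proof (induction P rule: int_poly_additive_induct)
    case (single m c)
    show ?case
      unfolding single_eq_prod_pvar by (intro mult int prod power pvar)
  qed (fact zero add)+
qed

lemma lookup_of_nat_mult:
  "Poly_Mapping.lookup (of_nat n * (P :: 'v int_poly)) m = int n * Poly_Mapping.lookup P m"
  by (induction n) (simp_all add: algebra_simps lookup_add)

lemma int_poly_mult_of_nat_eq_0_iff:
  "of_nat n * (P :: 'v int_poly) = 0 \<longleftrightarrow> n = 0 \<or> P = 0"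
  by (auto simp: poly_mapping_eq_iff fun_eq_iff lookup_of_nat_mult)

lemma int_poly_of_nat_power_cancel:
  "n \<noteq> 0 \<Longrightarrow> of_nat n ^ k * (P :: 'v int_poly) = of_nat n ^ k * Q \<longleftrightarrow> P = Q"
  using int_poly_mult_of_nat_eq_0_iff[of "n ^ k" "P - Q"]
  by (auto simp: algebra_simps)


section \<open>Witt's theorem\<close>

text \<open>When p divides \<open>c - d\<close>, the cofactor of \<open>c - d\<close> in
  \<open>c ^ p - d ^ p\<close> is congruent modulo p to \<open>p * d ^ (p - 1)\<close>, hence
  divisible by p. Each further p-th power therefore gains one factor p.\<close>

lemma dvd_prime_power_diff:
  fixes a b :: "'a::comm_ring_1"
  assumes "of_nat p dvd a - b"
  shows "of_nat p ^ Suc k dvd a ^ (p ^ k) - b ^ (p ^ k)"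
proof (induction k)
  case 0
  then show ?case using assms by simp
next
  case (Suc k)
  define c d where "c = a ^ (p ^ k)" and "d = b ^ (p ^ k)"
  have dvd: "of_nat p ^ Suc k dvd c - d"
    using Suc by (simp add: c_def d_def)
  have "of_nat p dvd c - d"
    using dvd_trans[OF _ dvd] by simp
  then have "of_nat p dvd (\<Sum>i<p. d ^ (p - Suc i) * c ^ i - d ^ (p - Suc i) * d ^ i)"
    by (intro dvd_sum) (auto simp: power_diff_sumr2 simp flip: right_diff_distrib)
  moreover have "(\<Sum>i<p. d ^ (p - Suc i) * d ^ i) = of_nat p * d ^ (p - 1)"
    by (simp flip: power_add)
  ultimately have "of_nat p dvd (\<Sum>i<p. d ^ (p - Suc i) * c ^ i)"
    by (simp add: sum_subtractf) (metis diff_add_cancel dvd_add dvd_triv_left)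
  with dvd have "of_nat p ^ Suc k * of_nat p dvd (c - d) * (\<Sum>i<p. d ^ (p - Suc i) * c ^ i)"
    by (rule mult_dvd_mono)
  also have "(c - d) * (\<Sum>i<p. d ^ (p - Suc i) * c ^ i) = c ^ p - d ^ p"
    by (rule power_diff_sumr2[symmetric])
  finally show ?case
    by (simp add: c_def d_def mult.commute flip: power_mult)
qed

lemma ghost_Suc: "ghost p (Suc n) x = ghost p n (\<lambda>i. x i ^ p) + of_nat p ^ Suc n * x (Suc n)"
proof -
  have "p ^ (Suc n - i) = p * p ^ (n - i)" if "i \<le> n" for i
    using that by (simp add: Suc_diff_le)
  then show ?thesis
    by (simp add: ghost_def power_mult)
qed

lemma ghost_0 [simp]: "ghost p 0 x = x 0"
  by (simp add: ghost_def)

text \<open>The i-th terms differ by \<open>p ^ i\<close> times a difference of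
  \<open>p ^ (n - i)\<close>-th powers, and the latter is divisible by
  \<open>p ^ Suc (n - i)\<close>.\<close>

lemma ghost_cong_mod:
  fixes x y :: "nat \<Rightarrow> 'a::comm_ring_1"
  assumes "\<And>i. i \<le> n \<Longrightarrow> of_nat p dvd x i - y i"
  shows "of_nat p ^ Suc n dvd ghost p n x - ghost p n y"
  unfolding ghost_def sum_subtractf[symmetric] right_diff_distrib[symmetric]
proof (rule dvd_sum)
  fix i assume "i \<in> {..n}"
  then have "of_nat p ^ i * of_nat p ^ Suc (n - i) dvd
      of_nat p ^ i * (x i ^ p ^ (n - i) - y i ^ p ^ (n - i))"
    by (intro mult_dvd_mono dvd_prime_power_diff assms) auto
  then show "of_nat p ^ Suc n dvd of_nat p ^ i * (x i ^ p ^ (n - i) - y i ^ p ^ (n - i))"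
    using \<open>i \<in> {..n}\<close> by (simp flip: power_add power_Suc)
qed

text \<open>Once the components below i agree, the i-th ghost equation reduces to
  \<open>p ^ i * x i = p ^ i * y i\<close>, and integer polynomials are torsion-free.\<close>

lemma ghost_inj_below:
  fixes x y :: "nat \<Rightarrow> 'v int_poly"
  assumes "p \<noteq> 0" and "\<And>i. i < n \<Longrightarrow> ghost p i x = ghost p i y"
  shows "i < n \<Longrightarrow> x i = y i"
proof (induction i rule: less_induct)
  case (less i)
  show ?case
  proof (cases i)
    case 0
    then show ?thesis using assms(2)[of 0] less by simp
  next
    case (Suc j)
    have "ghost p j (\<lambda>i. x i ^ p) = ghost p j (\<lambda>i. y i ^ p)"
      using less Suc by (simp add: ghost_def)
    then show ?thesis
      using assms(2)[of i] less.prems assms(1) int_poly_of_nat_power_cancel[of p "Suc j" "x i" "y i"]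
      by (simp add: Suc ghost_Suc del: power_Suc)
  qed
qed

lemma ghost_inj:
  fixes x y :: "nat \<Rightarrow> 'v int_poly"
  assumes "p \<noteq> 0" and "\<And>n. ghost p n x = ghost p n y"
  shows "x = y"
  using ghost_inj_below[OF assms(1), of "Suc _" x y] assms(2) by blast

lemma diff_diff_swap: "(a - b) - (c - d) = (a - c) - (b - d)" for a :: "'a::ab_group_add"
  by simp

text \<open>A converse of \<open>ghost_cong_mod\<close>: ghost components determine Witt vectors
  modulo p. This is how multiplication by p is computed in characteristic p.\<close>

lemma ghost_cong_mod_iff:
  fixes x y :: "nat \<Rightarrow> 'v int_poly"
  assumes "p \<noteq> 0" and "\<And>n. of_nat p ^ Suc n dvd ghost p n x - ghost p n y"
  shows "of_nat p dvd x i - y i"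
proof (induction i rule: less_induct)
  case (less i)
  show ?case
  proof (cases i)
    case 0
    then show ?thesis using assms(2)[of 0] by simp
  next
    case (Suc j)
    \<comment> \<open>Setting component 0 to 0 does not disturb congruence modulo p, while setting
      it in both vectors isolates nothing by itself; combined with the vanishing of component i
      below, the remaining difference is \<open>p ^ i * (x i - y i)\<close>.\<close>
    have "of_nat p ^ Suc i dvd (ghost p i x - ghost p i y) -
        (ghost p i (x(i := 0)) - ghost p i (y(i := 0)))"
    proof (rule dvd_diff[OF assms(2) ghost_cong_mod])
      show "of_nat p dvd (x(i := 0)) k - (y(i := 0)) k" if "k \<le> i" for k
        using less that by auto
    qed
    moreover have gh: "ghost p i z - ghost p i (z(i := 0)) = of_nat p ^ i * z i" for z :: "nat \<Rightarrow> 'v int_poly"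
      by (simp add: Suc ghost_Suc) (simp add: ghost_def)
    ultimately have "of_nat p ^ Suc i dvd of_nat p ^ i * (x i - y i)"
      by (subst (asm) diff_diff_swap) (simp only: gh right_diff_distrib)
    then obtain c where "of_nat p ^ i * (x i - y i) = of_nat p ^ Suc i * c" by (rule dvdE)
    then have "of_nat p ^ i * (x i - y i) = of_nat p ^ i * (of_nat p * c)" by (simp add: mult_ac)
    then show ?thesis
      using int_poly_of_nat_power_cancel[OF assms(1)] by (metis dvd_triv_left)
  qed
qed

section \<open>The Frobenius lift and Dwork's lemma\<close>

lemma prime_dvd_power_add_diff:
  fixes a b :: "'a::comm_ring_1"
  assumes "prime p"
  shows "of_nat p dvd (a + b) ^ p - (a ^ p + b ^ p)"
proof -
  have "(a + b) ^ p = (\<Sum>k\<le>p. of_nat (p choose k) * a ^ k * b ^ (p - k))"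
    by (rule binomial_ring)
  also have "\<dots> = (\<Sum>k\<in>{0,p}. of_nat (p choose k) * a ^ k * b ^ (p - k)) +
      (\<Sum>k\<in>{..p} - {0,p}. of_nat (p choose k) * a ^ k * b ^ (p - k))"
    by (subst sum.subset_diff[of "{0,p}"]) (auto simp: add.commute)
  also have "(\<Sum>k\<in>{0,p}. of_nat (p choose k) * a ^ k * b ^ (p - k)) = a ^ p + b ^ p"
    using prime_gt_0_nat[OF assms] by simp
  finally have "(a + b) ^ p - (a ^ p + b ^ p) =
      (\<Sum>k\<in>{..p} - {0,p}. of_nat (p choose k) * a ^ k * b ^ (p - k))"
    by simp
  also have "of_nat p dvd \<dots>"
  proof (rule dvd_sum)
    fix k assume "k \<in> {..p} - {0, p}"
    then have "p dvd (p choose k)"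
      using assms by (intro dvd_choose_prime) auto
    then show "of_nat p dvd of_nat (p choose k) * a ^ k * b ^ (p - k)"
      by (auto simp: mult.assoc)
  qed
  finally show ?thesis .
qed

definition frob_lift :: "nat \<Rightarrow> 'v int_poly \<Rightarrow> 'v int_poly" where
  "frob_lift p = peval (\<lambda>v. pvar v ^ p)"

lemma comm_ring_hom_frob_lift: "comm_ring_hom (frob_lift p)"
  unfolding frob_lift_def by (rule comm_ring_hom_peval)

text \<open>Both sides agree on variables, and modulo p the p-th power respects ring
  operations.\<close>

lemma frob_lift_cong:
  assumes "prime p"
  shows "of_nat p dvd frob_lift p P - P ^ p"
proof -
  interpret comm_ring_hom "frob_lift p :: 'a int_poly \<Rightarrow> _" by (rule comm_ring_hom_frob_lift)
  show ?thesis
  proof (induction P rule: int_poly_induct)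
    case one
    show ?case by (simp add: hom_one)
  next
    case (uminus f)
    \<comment> \<open>For p = 2 the sign does not come out of the power; additivity modulo p applied
      to \<open>f\<close> and \<open>- f\<close> treats all primes alike.\<close>
    have "of_nat p dvd (f + - f) ^ p - (f ^ p + (- f) ^ p)"
      using assms by (rule prime_dvd_power_add_diff)
    then have "of_nat p dvd - (f ^ p + (- f) ^ p)"
      using prime_gt_0_nat[OF assms] by (simp add: zero_power del: minus_add_distrib)
    moreover have "- (a + b) - (c - a) = - c - b" for a b c :: "'a int_poly"
      by simp
    ultimately show ?case
      using dvd_diff[OF _ uminus] by (metis hom_uminus)
  next
    case (add f g)
    have "of_nat p dvd (frob_lift p f - f ^ p) + (frob_lift p g - g ^ p)
        - ((f + g) ^ p - (f ^ p + g ^ p))"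
      by (rule dvd_diff[OF dvd_add[OF add] prime_dvd_power_add_diff[OF assms]])
    then show ?case by (simp add: hom_add algebra_simps)
  next
    case (mult f g)
    have "of_nat p dvd (frob_lift p f - f ^ p) * frob_lift p g + f ^ p * (frob_lift p g - g ^ p)"
      using mult by (intro dvd_add dvd_mult dvd_mult2)
    then show ?case by (simp add: hom_mult algebra_simps power_mult_distrib)
  next
    case (pvar v)
    show ?case by (simp add: frob_lift_def)
  qed
qed

text \<open>Dwork's lemma. With S known up to m, the hypothesis and the congruence of
  \<open>frob_lift p P\<close> with \<open>P ^ p\<close> make
  \<open>t (Suc m) - ghost p m (\<lambda>i. S i ^ p)\<close> divisible by \<open>p ^ Suc m\<close>;
  the quotient is the next component.\<close>

lemma dwork_exists:
  fixes t :: "nat \<Rightarrow> 'v int_poly"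
  assumes "prime p" and t: "\<And>n. of_nat p ^ Suc n dvd t (Suc n) - frob_lift p (t n)"
  shows "\<exists>S. \<forall>n. ghost p n S = t n"
proof -
  have p0: "p \<noteq> 0" using assms(1) by auto
  interpret comm_ring_hom "frob_lift p :: 'v int_poly \<Rightarrow> _" by (rule comm_ring_hom_frob_lift)
  have "\<exists>S. \<forall>i<n. ghost p i S = t i" for n
  proof (induction n)
    case 0
    show ?case by simp
  next
    case (Suc n)
    then obtain S where S: "\<And>i. i < n \<Longrightarrow> ghost p i S = t i" by auto
    have "\<exists>c. ghost p n (S(n := c)) = t n"
    proof (cases n)
      case 0
      then show ?thesis by (auto intro: exI[of _ "t 0"])
    next
      case (Suc m)
      have "frob_lift p (t m) = ghost p m (\<lambda>i. frob_lift p (S i))"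
        using S[of m] Suc by (simp flip: hom_ghost)
      moreover have "of_nat p ^ Suc m dvd
          ghost p m (\<lambda>i. frob_lift p (S i)) - ghost p m (\<lambda>i. S i ^ p)"
        using assms(1) by (intro ghost_cong_mod frob_lift_cong)
      ultimately have "of_nat p ^ n dvd (t n - frob_lift p (t m)) +
          (frob_lift p (t m) - ghost p m (\<lambda>i. S i ^ p))"
        unfolding Suc by (intro dvd_add t) simp
      then obtain c where "t n - ghost p m (\<lambda>i. S i ^ p) = of_nat p ^ n * c"
        by (auto elim: dvdE)
      then have "ghost p n (S(n := c)) = t n"
        unfolding Suc ghost_Suc by (simp add: ghost_def algebra_simps)
      then show ?thesis ..
    qed
    then obtain c where c: "ghost p n (S(n := c)) = t n" ..
    have "ghost p i (S(n := c)) = t i" if "i < Suc n" for i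
    proof (cases "i = n")
      case False
      then have "ghost p i (S(n := c)) = ghost p i S"
        using that by (auto simp: ghost_def intro!: sum.cong)
      then show ?thesis using S False that by simp
    qed (use c in simp)
    then show ?case by blast
  qed
  \<comment> \<open>Solutions chosen for different lengths agree on the common range because the
    ghost map is injective, so the diagonal is a single solution.\<close>
  then obtain S where S: "\<And>n i. i < n \<Longrightarrow> ghost p i (S n) = t i" by metis
  have "S (Suc i) i = S (Suc n) i" if "i \<le> n" for i n
    by (rule ghost_inj_below[OF p0, of "Suc i"]) (use S that in auto)
  then have "ghost p n (\<lambda>i. S (Suc i) i) = ghost p n (S (Suc n))" for n
    by (simp add: ghost_def)
  with S show ?thesis by (intro exI[of _ "\<lambda>i. S (Suc i) i"]) simp
qed

text \<open>The difference is exactly \<open>p ^ Suc n\<close> times the variable of index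
  \<open>Suc n\<close>.\<close>

lemma ghost_pvar_dwork:
  "of_nat p ^ Suc n dvd ghost p (Suc n) (\<lambda>i. pvar (v i)) - frob_lift p (ghost p n (\<lambda>i. pvar (v i)))"
proof -
  interpret comm_ring_hom "frob_lift p :: 'a int_poly \<Rightarrow> _" by (rule comm_ring_hom_frob_lift)
  show ?thesis
    by (simp add: ghost_Suc hom_ghost) (simp add: frob_lift_def)
qed

text \<open>Existence by Dwork's lemma and uniqueness by \<open>ghost_inj\<close> give the definite
  description its meaning.\<close>

lemma witt_add_poly_ghost:
  assumes "prime p"
  shows "ghost p n (witt_add_poly p) =
    ghost p n (\<lambda>i. pvar (Inl i)) + ghost p n (\<lambda>i. pvar (Inr i))"
proof -
  interpret comm_ring_hom "frob_lift p :: (nat + nat) int_poly \<Rightarrow> _" by (rule comm_ring_hom_frob_lift)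
  let ?t = "\<lambda>n. ghost p n (\<lambda>i. pvar (Inl i)) + ghost p n (\<lambda>i. pvar (Inr i)) :: witt_poly"
  have "of_nat p ^ Suc n dvd ?t (Suc n) - frob_lift p (?t n)" for n
    using dvd_add[OF ghost_pvar_dwork[of p n Inl] ghost_pvar_dwork[of p n Inr]]
    by (simp add: hom_add algebra_simps)
  from dwork_exists[OF assms this] have "\<exists>!S. \<forall>n. ghost p n S = ?t n"
    using prime_gt_0_nat[OF assms] by (auto intro: ghost_inj[of p])
  from theI'[OF this] show ?thesis
    by (simp add: witt_add_poly_def poly_var_eq_pvar)
qed

lemma witt_mult_poly_ghost:
  assumes "prime p"
  shows "ghost p n (witt_mult_poly p) =
    ghost p n (\<lambda>i. pvar (Inl i)) * ghost p n (\<lambda>i. pvar (Inr i))"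
proof -
  interpret comm_ring_hom "frob_lift p :: (nat + nat) int_poly \<Rightarrow> _" by (rule comm_ring_hom_frob_lift)
  let ?X = "\<lambda>n. ghost p n (\<lambda>i. pvar (Inl i)) :: witt_poly"
  let ?Y = "\<lambda>n. ghost p n (\<lambda>i. pvar (Inr i)) :: witt_poly"
  have "of_nat p ^ Suc n dvd ?X (Suc n) * ?Y (Suc n) - frob_lift p (?X n * ?Y n)" for n
    using dvd_add[OF dvd_mult2[OF ghost_pvar_dwork[of p n Inl], of "?Y (Suc n)"]
        dvd_mult[OF ghost_pvar_dwork[of p n Inr], of "frob_lift p (?X n)"]]
    by (simp add: hom_mult algebra_simps)
  from dwork_exists[OF assms this] have "\<exists>!S. \<forall>n. ghost p n S = ?X n * ?Y n"
    using prime_gt_0_nat[OF assms] by (auto intro: ghost_inj[of p])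
  from theI'[OF this] show ?thesis
    by (simp add: witt_mult_poly_def poly_var_eq_pvar)
qed


section \<open>The ring of Witt vectors as a type\<close>

definition wadd :: "nat \<Rightarrow> (nat \<Rightarrow> 'a::comm_ring_1) \<Rightarrow> (nat \<Rightarrow> 'a) \<Rightarrow> nat \<Rightarrow> 'a" where
  "wadd p x y = (\<lambda>n. peval (case_sum x y) (witt_add_poly p n))"

definition wmult :: "nat \<Rightarrow> (nat \<Rightarrow> 'a::comm_ring_1) \<Rightarrow> (nat \<Rightarrow> 'a) \<Rightarrow> nat \<Rightarrow> 'a" where
  "wmult p x y = (\<lambda>n. peval (case_sum x y) (witt_mult_poly p n))"

lemma ghost_wadd:
  assumes "prime p"
  shows "ghost p n (wadd p x y) = ghost p n x + ghost p n y"
proof -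
  interpret comm_ring_hom "peval (case_sum x y)" by (rule comm_ring_hom_peval)
  show ?thesis
    using arg_cong[OF witt_add_poly_ghost[OF assms, of n], of "peval (case_sum x y)"]
    by (simp add: wadd_def hom_ghost hom_add)
qed

lemma ghost_wmult:
  assumes "prime p"
  shows "ghost p n (wmult p x y) = ghost p n x * ghost p n y"
proof -
  interpret comm_ring_hom "peval (case_sum x y)" by (rule comm_ring_hom_peval)
  show ?thesis
    using arg_cong[OF witt_mult_poly_ghost[OF assms, of n], of "peval (case_sum x y)"]
    by (simp add: wmult_def hom_ghost hom_mult)
qed

context comm_ring_hom
begin

lemma hom_case_sum: "(\<lambda>v. h (case_sum x y v)) = case_sum (\<lambda>i. h (x i)) (\<lambda>i. h (y i))"
  by (auto simp: fun_eq_iff split: sum.split)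

lemma hom_wadd: "h (wadd p x y n) = wadd p (\<lambda>i. h (x i)) (\<lambda>i. h (y i)) n"
  by (simp add: wadd_def hom_peval hom_case_sum)

lemma hom_wmult: "h (wmult p x y n) = wmult p (\<lambda>i. h (x i)) (\<lambda>i. h (y i)) n"
  by (simp add: wmult_def hom_peval hom_case_sum)

end

lemma teich_0 [simp]: "teich a 0 = a"
  by (simp add: teich_def)

lemma ghost_teich: "p \<noteq> 0 \<Longrightarrow> ghost p n (teich a) = a ^ (p ^ n)"
  by (simp add: ghost_def sum.atMost_shift) (simp add: teich_def zero_power)

lemma ghost_zero: "p \<noteq> 0 \<Longrightarrow> ghost p n (\<lambda>_. 0) = 0"
  by (simp add: ghost_def zero_power)

lemma ghost_case_nat:
  "ghost p (Suc n) (case_nat a x) = a ^ (p ^ Suc n) + of_nat p * ghost p n x"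
  by (simp add: ghost_def sum.atMost_Suc_shift sum_distrib_left mult.assoc del: sum.atMost_Suc)

text \<open>
  Every commutative ring is a quotient of a polynomial ring over the integers, on whose Witt
  vectors the ghost map is injective. Identities between Witt vectors are therefore checked
  on ghost components.
\<close>

abbreviation pvars :: "(nat \<Rightarrow> 'a) \<Rightarrow> nat \<Rightarrow> 'a int_poly" where
  "pvars x \<equiv> (\<lambda>i. pvar (x i))"

abbreviation pvalue :: "'a::comm_ring_1 int_poly \<Rightarrow> 'a" where
  "pvalue \<equiv> peval (\<lambda>a. a)"

interpretation pvalue: comm_ring_hom pvalue
  by (rule comm_ring_hom_peval)

lemma pvalue_teich: "(\<lambda>i. pvalue (teich a i)) = teich (pvalue a)"
  by (auto simp: teich_def pvalue.hom_zero)

lemma pvalue_case_nat: "(\<lambda>i. pvalue (case_nat a x i)) = case_nat (pvalue a) (\<lambda>i. pvalue (x i))"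
  by (auto split: nat.split)

lemmas pvalue_simps = pvalue.hom_wadd pvalue.hom_wmult pvalue_teich pvalue_case_nat
  pvalue.hom_zero pvalue.hom_one

lemma ghost_eq_imp_pvalue_eq:
  assumes "prime p" and "\<And>n. ghost p n x = ghost p n y"
  shows "(\<lambda>i. pvalue (x i)) = (\<lambda>i. pvalue (y i))"
  using ghost_inj[of p x y] assms by (metis not_prime_0)

lemma wadd_assoc: "prime p \<Longrightarrow> wadd p (wadd p x y) z = wadd p x (wadd p y z)"
  using ghost_eq_imp_pvalue_eq[of p "wadd p (wadd p (pvars x) (pvars y)) (pvars z)"
      "wadd p (pvars x) (wadd p (pvars y) (pvars z))"]
  by (simp add: ghost_wadd pvalue_simps add.assoc)

lemma wadd_commute: "prime p \<Longrightarrow> wadd p x y = wadd p y x"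
  using ghost_eq_imp_pvalue_eq[of p "wadd p (pvars x) (pvars y)" "wadd p (pvars y) (pvars x)"]
  by (simp add: ghost_wadd pvalue_simps add.commute)

lemma wadd_zero: "prime p \<Longrightarrow> wadd p (\<lambda>_. 0) x = x"
  using ghost_eq_imp_pvalue_eq[of p "wadd p (\<lambda>_. 0) (pvars x)" "pvars x"]
  by (simp add: ghost_wadd ghost_zero prime_gt_0_nat pvalue_simps)

lemma wmult_assoc: "prime p \<Longrightarrow> wmult p (wmult p x y) z = wmult p x (wmult p y z)"
  using ghost_eq_imp_pvalue_eq[of p "wmult p (wmult p (pvars x) (pvars y)) (pvars z)"
      "wmult p (pvars x) (wmult p (pvars y) (pvars z))"]
  by (simp add: ghost_wmult pvalue_simps mult.assoc)

lemma wmult_commute: "prime p \<Longrightarrow> wmult p x y = wmult p y x"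
  using ghost_eq_imp_pvalue_eq[of p "wmult p (pvars x) (pvars y)" "wmult p (pvars y) (pvars x)"]
  by (simp add: ghost_wmult pvalue_simps mult.commute)

lemma wmult_one: "prime p \<Longrightarrow> wmult p (teich 1) x = x"
  using ghost_eq_imp_pvalue_eq[of p "wmult p (teich 1) (pvars x)" "pvars x"]
  by (simp add: ghost_wmult ghost_teich prime_gt_0_nat pvalue_simps)

lemma wmult_distrib: "prime p \<Longrightarrow> wmult p (wadd p x y) z = wadd p (wmult p x z) (wmult p y z)"
  using ghost_eq_imp_pvalue_eq[of p "wmult p (wadd p (pvars x) (pvars y)) (pvars z)"
      "wadd p (wmult p (pvars x) (pvars z)) (wmult p (pvars y) (pvars z))"]
  by (simp add: ghost_wmult ghost_wadd pvalue_simps distrib_right)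

text \<open>For p = 2 negation is not componentwise, so Dwork's lemma is applied to the negated
  ghost components.\<close>

lemma wadd_inverse_exists:
  fixes x :: "nat \<Rightarrow> 'a::comm_ring_1"
  assumes p: "prime p"
  shows "\<exists>y. wadd p x y = (\<lambda>_. 0)"
proof -
  interpret comm_ring_hom "frob_lift p :: 'a int_poly \<Rightarrow> _" by (rule comm_ring_hom_frob_lift)
  have "of_nat p ^ Suc n dvd - ghost p (Suc n) (pvars x) - frob_lift p (- ghost p n (pvars x))" for n
    using dvd_minus_iff[THEN iffD2, OF ghost_pvar_dwork[of p n x]] by (simp add: hom_uminus)
  from dwork_exists[OF p this] obtain S where S: "\<And>n. ghost p n S = - ghost p n (pvars x)" by auto
  have "wadd p x (\<lambda>i. pvalue (S i)) = (\<lambda>_. 0)"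
    using ghost_eq_imp_pvalue_eq[of p "wadd p (pvars x) S" "\<lambda>_. 0"] p
    by (simp add: ghost_wadd S ghost_zero prime_gt_0_nat pvalue_simps)
  then show ?thesis by blast
qed

text \<open>The ghost components of a shifted vector are 0 followed by p times those of the
  original, so the shift is additive.\<close>

lemma wadd_case_nat:
  "prime p \<Longrightarrow> wadd p (case_nat 0 x) (case_nat 0 y) = case_nat 0 (wadd p x y)"
proof -
  assume p: "prime p"
  have "ghost p n (wadd p (case_nat 0 (pvars x)) (case_nat 0 (pvars y))) =
      ghost p n (case_nat 0 (wadd p (pvars x) (pvars y)))" for n
    using prime_gt_0_nat[OF p]
    by (cases n) (simp_all only: ghost_wadd[OF p] ghost_case_nat, simp_all add: distrib_left zero_power)
  from ghost_eq_imp_pvalue_eq[OF p this] show ?thesis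
    by (simp add: pvalue_simps)
qed

lemma wadd_teich_case_nat: "prime p \<Longrightarrow> wadd p (teich a) (case_nat 0 x) = case_nat a x"
proof -
  assume p: "prime p"
  have "ghost p n (wadd p (teich (pvar a)) (case_nat 0 (pvars x))) =
      ghost p n (case_nat (pvar a) (pvars x))" for n
    using prime_gt_0_nat[OF p]
    by (cases n)
       (simp_all only: ghost_wadd[OF p] ghost_case_nat, simp_all add: ghost_teich zero_power)
  from ghost_eq_imp_pvalue_eq[OF p this] show ?thesis
    by (simp add: pvalue_simps)
qed

text \<open>The identity \<open>p = V F\<close>, with iterated addition written as a power of a map
  since the ring structure comes later. The n-th ghost components of p X and V (F X) differ by
  \<open>p ^ Suc n * X n\<close>, so the components are congruent modulo p and coincide in
  characteristic p.\<close>

lemma wadd_funpow_eq: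
  fixes x :: "nat \<Rightarrow> 'a::comm_ring_1"
  assumes p: "prime p" "CHAR('a) = p"
  shows "(wadd p x ^^ p) (\<lambda>_. 0) = case_nat 0 (\<lambda>i. x i ^ p)"
proof -
  have p0: "p \<noteq> 0" using p by auto
  have gh: "ghost p n ((wadd p (pvars x) ^^ k) (\<lambda>_. 0)) = of_nat k * ghost p n (pvars x)" for n k
    by (induction k) (simp_all add: ghost_wadd[OF p(1)] ghost_zero p0 algebra_simps)
  have "of_nat p dvd (wadd p (pvars x) ^^ p) (\<lambda>_. 0) i - case_nat 0 (\<lambda>i. pvar (x i) ^ p) i" for i
  proof (rule ghost_cong_mod_iff[OF p0])
    fix n
    show "of_nat p ^ Suc n dvd ghost p n ((wadd p (pvars x) ^^ p) (\<lambda>_. 0)) -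
        ghost p n (case_nat 0 (\<lambda>i. pvar (x i) ^ p))"
    proof (cases n)
      case 0
      then show ?thesis using gh[of 0 p] by simp
    next
      case (Suc m)
      then show ?thesis
        unfolding gh Suc ghost_case_nat unfolding ghost_Suc
        using p0 by (simp add: algebra_simps zero_power) (intro mult_dvd_mono, simp_all)
    qed
  qed
  then have "pvalue (of_nat p) dvd pvalue ((wadd p (pvars x) ^^ p) (\<lambda>_. 0) i -
      case_nat 0 (\<lambda>i. pvar (x i) ^ p) i)" for i
    by (metis dvdE dvdI pvalue.hom_mult)
  then have "pvalue ((wadd p (pvars x) ^^ p) (\<lambda>_. 0) i) = pvalue (case_nat 0 (\<lambda>i. pvar (x i) ^ p) i)" for i
    using p(2) of_nat_CHAR[where 'a = 'a] by (simp add: pvalue.hom_of_nat pvalue.hom_diff)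
  moreover have "(\<lambda>i. pvalue ((wadd p (pvars x) ^^ k) (\<lambda>_. 0) i)) = (wadd p x ^^ k) (\<lambda>_. 0)" for k
    by (induction k) (simp_all add: pvalue_simps)
  ultimately show ?thesis
    by (auto simp: fun_eq_iff pvalue.hom_power pvalue.hom_zero split: nat.splits)
qed


text \<open>A separate type can be made an instance of \<open>comm_ring_1\<close>, which gives
  access to sums, \<open>of_nat\<close> and ring simplification. The results are carried back to
  \<open>witt_ring\<close> at the end.\<close>

datatype 'a witt = Witt (wnth: "nat \<Rightarrow> 'a")

lemma witt_eqI: "(\<And>n. wnth x n = wnth y n) \<Longrightarrow> x = y"
  by (rule witt.expand) (simp add: fun_eq_iff)

lemma wnth_map_witt [simp]: "wnth (map_witt h x) = (\<lambda>n. h (wnth x n))"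
  by (simp add: witt.map_sel comp_def)

text \<open>
  Only rings of prime characteristic \<open>p\<close> matter here. The value \<open>2\<close> elsewhere makes the ring
  instance unconditional.
\<close>

definition witt_prime :: "'a::comm_ring_1 itself \<Rightarrow> nat" where
  "witt_prime _ = (if prime CHAR('a) then CHAR('a) else 2)"

lemma prime_witt_prime: "prime (witt_prime TYPE('a::comm_ring_1))"
  by (simp add: witt_prime_def)

lemma witt_prime_eq: "prime CHAR('a::comm_ring_1) \<Longrightarrow> witt_prime TYPE('a) = CHAR('a)"
  by (simp add: witt_prime_def)

instantiation witt :: (comm_ring_1) comm_ring_1
begin

definition zero_witt :: "'a witt" where
  "zero_witt = Witt (\<lambda>_. 0)"

definition one_witt :: "'a witt" where
  "one_witt = Witt (teich 1)"

definition plus_witt :: "'a witt \<Rightarrow> 'a witt \<Rightarrow> 'a witt" where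
  "plus_witt x y = Witt (wadd (witt_prime TYPE('a)) (wnth x) (wnth y))"

definition times_witt :: "'a witt \<Rightarrow> 'a witt \<Rightarrow> 'a witt" where
  "times_witt x y = Witt (wmult (witt_prime TYPE('a)) (wnth x) (wnth y))"

definition uminus_witt :: "'a witt \<Rightarrow> 'a witt" where
  "uminus_witt x = (SOME y. y + x = 0)"

definition minus_witt :: "'a witt \<Rightarrow> 'a witt \<Rightarrow> 'a witt" where
  "minus_witt x y = x + - y"

instance
proof
  fix x y z :: "'a witt"
  note p = prime_witt_prime[where 'a = 'a]
  show "x + y + z = x + (y + z)"
    by (simp add: plus_witt_def wadd_assoc[OF p])
  show "x + y = y + x"
    by (simp add: plus_witt_def wadd_commute[OF p])
  show "0 + x = x"
    by (simp add: plus_witt_def zero_witt_def wadd_zero[OF p])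
  show "x * y * z = x * (y * z)"
    by (simp add: times_witt_def wmult_assoc[OF p])
  show "x * y = y * x"
    by (simp add: times_witt_def wmult_commute[OF p])
  show "1 * x = x"
    by (simp add: times_witt_def one_witt_def wmult_one[OF p])
  show "(x + y) * z = x * z + y * z"
    by (simp add: times_witt_def plus_witt_def wmult_distrib[OF p])
  show "x - y = x + - y"
    by (rule minus_witt_def)
  obtain w where "wadd (witt_prime TYPE('a)) (wnth x) w = (\<lambda>_. 0)"
    using wadd_inverse_exists[OF p] by blast
  then have "Witt w + x = 0"
    by (simp add: plus_witt_def zero_witt_def wadd_commute[OF p])
  then show "- x + x = 0"
    unfolding uminus_witt_def by (rule someI)
  show "(0 :: 'a witt) \<noteq> 1"
    by (auto simp: zero_witt_def one_witt_def teich_def fun_eq_iff)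
qed

end

lemma wnth_0 [simp]: "wnth 0 = (\<lambda>_. 0)"
  by (simp add: zero_witt_def)

lemma wnth_1 [simp]: "wnth 1 = teich 1"
  by (simp add: one_witt_def)

lemma wnth_add_0 [simp]: "wnth (x + y) 0 = wnth x 0 + wnth y 0"
  using ghost_wadd[OF prime_witt_prime, of 0] by (simp add: plus_witt_def)

lemma wnth_mult_0 [simp]: "wnth (x * y) 0 = wnth x 0 * wnth y 0"
  using ghost_wmult[OF prime_witt_prime, of 0] by (simp add: times_witt_def)

interpretation wnth_0: comm_ring_hom "\<lambda>x. wnth x 0"
  by standard (simp_all add: teich_def)

lemma comm_ring_hom_map_witt:
  fixes h :: "'a::comm_ring_1 \<Rightarrow> 'b::comm_ring_1"
  assumes "comm_ring_hom h" and "CHAR('a) = CHAR('b)"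
  shows "comm_ring_hom (map_witt h)"
proof -
  interpret comm_ring_hom h by fact
  have eq: "witt_prime TYPE('a) = witt_prime TYPE('b)"
    using assms(2) by (simp add: witt_prime_def)
  show ?thesis
    by standard
       (auto intro!: witt_eqI simp: plus_witt_def times_witt_def hom_wadd hom_wmult eq teich_def
         hom_one hom_zero comp_def)
qed

definition wteich :: "'a::zero \<Rightarrow> 'a witt" where
  "wteich a = Witt (teich a)"

text \<open>The Verschiebung V. The shift \<open>wtl\<close> inverts it on vectors with vanishing
  component 0.\<close>

definition wver :: "'a::zero witt \<Rightarrow> 'a witt" where
  "wver x = Witt (case_nat 0 (wnth x))"

definition wtl :: "'a witt \<Rightarrow> 'a witt" where
  "wtl x = Witt (\<lambda>n. wnth x (Suc n))"

definition wfrob :: "'a::comm_ring_1 witt \<Rightarrow> 'a witt" where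
  "wfrob = map_witt (\<lambda>a. a ^ CHAR('a))"

lemma wnth_wteich [simp]: "wnth (wteich a) = teich a"
  by (simp add: wteich_def)

lemma wnth_wver_0 [simp]: "wnth (wver x) 0 = 0"
  by (simp add: wver_def)

lemma wnth_wver_Suc [simp]: "wnth (wver x) (Suc n) = wnth x n"
  by (simp add: wver_def)

lemma wnth_wtl [simp]: "wnth (wtl x) n = wnth x (Suc n)"
  by (simp add: wtl_def)

lemma wnth_wfrob [simp]: "wnth (wfrob (x :: 'a::comm_ring_1 witt)) n = wnth x n ^ CHAR('a)"
  by (simp add: wfrob_def)

lemma wver_add: "wver (x + y) = wver x + wver y"
  by (simp add: wver_def plus_witt_def wadd_case_nat[OF prime_witt_prime])

lemma wteich_add_wver: "wteich a + wver x = Witt (case_nat a (wnth x))"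
  by (simp add: wver_def wteich_def plus_witt_def wadd_teich_case_nat[OF prime_witt_prime])

lemma wteich_0 [simp]: "wteich 0 = 0"
  by (rule witt_eqI) (simp add: teich_def)

lemma wteich_wver_decomp: "x = wteich (wnth x 0) + wver (wtl x)"
  unfolding wteich_add_wver by (rule witt_eqI) (simp split: nat.split)

lemma wver_0 [simp]: "wver 0 = 0"
  by (rule witt_eqI) (simp add: wver_def split: nat.split)

lemma wver_uminus: "wver (- x) = - wver x"
  using wver_add[of x "- x"] by (simp add: eq_neg_iff_add_eq_0 add.commute)

lemma wver_diff: "wver (x - y) = wver x - wver y"
  using wver_add[of x "- y"] by (simp add: wver_uminus)

lemma wver_eq_iff [simp]: "wver x = wver y \<longleftrightarrow> x = y"
proof
  assume "wver x = wver y"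
  then have "wnth (wver x) (Suc n) = wnth (wver y) (Suc n)" for n by simp
  then show "x = y" by (intro witt_eqI) simp
qed simp

lemma wver_wtl: "wnth (x :: 'a::comm_ring_1 witt) 0 = 0 \<Longrightarrow> wver (wtl x) = x"
  using wteich_wver_decomp[of x] by simp

lemma comm_ring_hom_power_CHAR:
  "prime CHAR('a::comm_ring_1) \<Longrightarrow> comm_ring_hom (\<lambda>a::'a. a ^ CHAR('a))"
  by standard (simp_all add: freshmans_dream power_mult_distrib)

lemma comm_ring_hom_wfrob:
  "prime CHAR('a::comm_ring_1) \<Longrightarrow> comm_ring_hom (wfrob :: 'a witt \<Rightarrow> 'a witt)"
  unfolding wfrob_def by (rule comm_ring_hom_map_witt) (simp_all add: comm_ring_hom_power_CHAR)

lemma wfrob_wteich: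
  "prime CHAR('a) \<Longrightarrow> wfrob (wteich (a::'a::comm_ring_1)) = wteich (a ^ CHAR('a))"
  by (rule witt_eqI) (auto simp: teich_def prime_gt_0_nat zero_power)

lemma wfrob_wver:
  "prime CHAR('a) \<Longrightarrow> wfrob (wver (x :: 'a::comm_ring_1 witt)) = wver (wfrob x)"
  by (rule witt_eqI) (auto simp: wver_def prime_gt_0_nat zero_power split: nat.split)

lemma of_nat_CHAR_mult_witt:
  fixes x :: "'a::comm_ring_1 witt"
  assumes "prime CHAR('a)"
  shows "of_nat CHAR('a) * x = wver (wfrob x)"
proof -
  have "wnth (of_nat k * x) = (wadd CHAR('a) (wnth x) ^^ k) (\<lambda>_. 0)" for k
    by (induction k) (simp_all add: distrib_right, simp add: plus_witt_def witt_prime_eq[OF assms])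
  from this[of "CHAR('a)"] show ?thesis
    by (intro witt_eqI) (simp add: wadd_funpow_eq[OF assms refl] wver_def split: nat.split)
qed

lemma map_witt_wver: "h 0 = 0 \<Longrightarrow> map_witt h (wver x) = wver (map_witt h x)"
  by (rule witt_eqI) (auto simp: wver_def split: nat.split)

lemma map_witt_wteich: "h 0 = 0 \<Longrightarrow> map_witt h (wteich a) = wteich (h a)"
  by (rule witt_eqI) (auto simp: teich_def)

lemma map_witt_wfrob:
  fixes h :: "'a::comm_ring_1 \<Rightarrow> 'b::comm_ring_1"
  assumes "comm_ring_hom h" and "CHAR('a) = CHAR('b)"
  shows "map_witt h (wfrob x) = wfrob (map_witt h x)"
  using assms(2) by (intro witt_eqI) (simp add: comm_ring_hom.hom_power[OF assms(1)])


section \<open>Convergent expansions\<close>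

text \<open>Membership in \<open>V ^ n W\<close>. Over the perfect field k this is divisibility by
  \<open>p ^ n\<close>; over K and for n > 0 it is weaker.\<close>

definition wlow :: "nat \<Rightarrow> 'a::zero witt \<Rightarrow> bool" where
  "wlow n x \<longleftrightarrow> (\<forall>i<n. wnth x i = 0)"

lemma wnth_wver_funpow:
  "wnth ((wver ^^ n) x) i = (if i < n then 0 else wnth x (i - n))"
  by (induction n arbitrary: i) (auto simp: wver_def Suc_diff_Suc split: nat.split)

lemma wver_funpow_add:
  "(wver ^^ n) (x + y) = (wver ^^ n) x + (wver ^^ n) (y :: 'a::comm_ring_1 witt)"
  by (induction n) (simp_all add: wver_add)

lemma wlow_iff: "wlow n x \<longleftrightarrow> (\<exists>d. x = (wver ^^ n) d)"
proof
  assume "wlow n x"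
  then have "x = (wver ^^ n) (Witt (\<lambda>i. wnth x (i + n)))"
    by (intro witt_eqI) (simp add: wnth_wver_funpow wlow_def)
  then show "\<exists>d. x = (wver ^^ n) d" ..
qed (auto simp: wlow_def wnth_wver_funpow)

lemma wlow_add: "wlow n x \<Longrightarrow> wlow n y \<Longrightarrow> wlow n (x + y :: 'a::comm_ring_1 witt)"
  by (metis wlow_iff wver_funpow_add)

lemma wlow_0 [simp]: "wlow n (0 :: 'a::comm_ring_1 witt)"
  by (simp add: wlow_def)

lemma wlow_uminus: "wlow n x \<Longrightarrow> wlow n (- x :: 'a::comm_ring_1 witt)"
proof -
  have "(wver ^^ n) (- d) = - (wver ^^ n) d" for d :: "'a witt"
    by (induction n) (simp_all add: wver_uminus)
  then show "wlow n x \<Longrightarrow> wlow n (- x)"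
    by (metis wlow_iff)
qed

lemma wlow_diff: "wlow n x \<Longrightarrow> wlow n y \<Longrightarrow> wlow n (x - y :: 'a::comm_ring_1 witt)"
  using wlow_add[of n x "- y"] by (simp add: wlow_uminus)

lemma wlow_wver: "wlow (Suc n) (wver x) \<longleftrightarrow> wlow n x"
  by (simp add: wlow_def All_less_Suc2)

lemma wlow_all_imp_0: "(\<And>n. wlow n x) \<Longrightarrow> x = (0 :: 'a::comm_ring_1 witt)"
  by (rule witt_eqI) (auto simp: wlow_def)

text \<open>Subtraction is not componentwise, but equal components 0 give equal Teichmueller parts,
  which cancel; as V is additive, the claim passes to the tails.\<close>

lemma wlow_diff_iff:
  "wlow n (x - y :: 'a::comm_ring_1 witt) \<longleftrightarrow> (\<forall>i<n. wnth x i = wnth y i)"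
proof (induction n arbitrary: x y)
  case 0
  show ?case by (simp add: wlow_def)
next
  case (Suc n)
  have "x - y = wver (wtl x - wtl y)" if "wnth x 0 = wnth y 0"
    using wteich_wver_decomp[of x] wteich_wver_decomp[of y] that
    by (metis add_diff_cancel_left wver_diff)
  then have "wlow (Suc n) (x - y) \<longleftrightarrow> wnth x 0 = wnth y 0 \<and> wlow n (wtl x - wtl y)"
    by (metis eq_iff_diff_eq_0 wlow_def wlow_wver wnth_0.hom_diff zero_less_Suc)
  then show ?case
    by (simp add: Suc All_less_Suc2)
qed

text \<open>The V-adic sum of the terms \<open>V ^ j (z j)\<close>. Component i is read off the
  partial sum through j = i, since later terms do not affect it.\<close>

definition wlim :: "(nat \<Rightarrow> 'a::comm_ring_1 witt) \<Rightarrow> 'a witt" where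
  "wlim z = Witt (\<lambda>i. wnth (\<Sum>j<Suc i. (wver ^^ j) (z j)) i)"

lemma wlow_wlim_diff: "wlow n (wlim z - (\<Sum>j<n. (wver ^^ j) (z j)))"
  unfolding wlow_diff_iff
proof (intro allI impI)
  fix i assume "i < n"
  have "wnth (\<Sum>j<Suc i. (wver ^^ j) (z j)) i = wnth (\<Sum>j<n. (wver ^^ j) (z j)) i"
    using Suc_leI[OF \<open>i < n\<close>]
  proof (induction n rule: dec_induct)
    case (step n)
    have "wlow n ((\<Sum>j<Suc n. (wver ^^ j) (z j)) - (\<Sum>j<n. (wver ^^ j) (z j)))"
      by (auto simp: wlow_iff)
    then have "wnth (\<Sum>j<Suc n. (wver ^^ j) (z j)) i = wnth (\<Sum>j<n. (wver ^^ j) (z j)) i"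
      using step.hyps by (simp only: wlow_diff_iff Suc_le_eq)
    then show ?case using step.IH by simp
  qed simp
  then show "wnth (wlim z) i = wnth (\<Sum>j<n. (wver ^^ j) (z j)) i"
    by (simp add: wlim_def)
qed

lemma wver_sum: "wver (sum f A) = (\<Sum>a\<in>A. wver (f a :: 'a::comm_ring_1 witt))"
  by (induction A rule: infinite_finite_induct) (simp_all add: wver_add)

lemma wlim_unfold: "wlim z = z 0 + wver (wlim (\<lambda>n. z (Suc n)))"
proof -
  let ?z' = "\<lambda>n. z (Suc n)"
  have "wlow n (wlim z - (z 0 + wver (wlim ?z')))" for n
  proof (cases n)
    case (Suc m)
    have "(\<Sum>j<Suc m. (wver ^^ j) (z j)) = z 0 + wver (\<Sum>j<m. (wver ^^ j) (?z' j))"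
      by (simp add: sum.lessThan_Suc_shift wver_sum del: sum.lessThan_Suc)
    then have "wlim z - (z 0 + wver (wlim ?z')) =
        (wlim z - (\<Sum>j<Suc m. (wver ^^ j) (z j))) -
        wver (wlim ?z' - (\<Sum>j<m. (wver ^^ j) (?z' j)))"
      by (simp add: wver_diff)
    also have "wlow (Suc m) \<dots>"
      by (intro wlow_diff wlow_wlim_diff) (simp add: wlow_wver wlow_wlim_diff)
    finally show ?thesis by (simp add: Suc)
  qed (simp add: wlow_def)
  from wlow_all_imp_0[OF this] show ?thesis by simp
qed

text \<open>The difference of two solutions satisfies \<open>d n = V (d (Suc n))\<close>, so it lies
  in every \<open>V ^ k W\<close>, and these meet in 0. Infinite sums are identified through such
  recursions instead of limit arguments.\<close>

lemma wlim_unique: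
  assumes "\<And>n. u n = z n + wver (u (Suc n))"
  shows "u 0 = wlim z"
proof -
  define d where "d n = u n - wlim (\<lambda>k. z (n + k))" for n
  have d: "d n = wver (d (Suc n))" for n
    unfolding d_def by (subst assms, subst wlim_unfold) (simp add: wver_diff)
  have "wlow k (d n)" for k n
  proof (induction k arbitrary: n)
    case (Suc k)
    then show ?case by (subst d) (simp add: wlow_wver)
  qed (simp add: wlow_def)
  from wlow_all_imp_0[OF this, of 0] show ?thesis by (simp add: d_def)
qed

section \<open>Sums with p in place of V\<close>

lemma wlow_CHAR_mult:
  assumes "prime CHAR('a)" and "wlow n x"
  shows "wlow (Suc n) (of_nat CHAR('a) * (x :: 'a::comm_ring_1 witt))"
  using assms
  by (simp add: of_nat_CHAR_mult_witt wlow_wver) (simp add: wlow_def zero_power prime_gt_0_nat)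

text \<open>Since \<open>p\<^sup>n = V\<^sup>n F\<^sup>n\<close>, this is the \<open>p\<close>-adic sum of the \<open>p\<^sup>n z\<^sub>n\<close>.\<close>

definition psum :: "(nat \<Rightarrow> 'a::comm_ring_1 witt) \<Rightarrow> 'a witt" where
  "psum z = wlim (\<lambda>n. (wfrob ^^ n) (z n))"

lemma psum_unfold:
  assumes "prime CHAR('a::comm_ring_1)"
  shows "psum z = z 0 + of_nat CHAR('a) * psum (\<lambda>n. z (Suc n) :: 'a witt)"
proof -
  interpret comm_ring_hom "wfrob :: 'a witt \<Rightarrow> 'a witt"
    by (rule comm_ring_hom_wfrob[OF assms])
  let ?w = "\<lambda>n. (wfrob ^^ n) (z (Suc n))"
  have "wfrob (wlim (\<lambda>k. ?w (n + k))) =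
      wfrob (?w n) + wver (wfrob (wlim (\<lambda>k. ?w (Suc n + k))))" for n
    by (subst wlim_unfold) (simp add: hom_add wfrob_wver[OF assms])
  \<comment> \<open>F commutes with the V-adic sum because both sides satisfy the same recursion;
    then \<open>V F = p\<close> yields the unfolding.\<close>
  from wlim_unique[of "\<lambda>n. wfrob (wlim (\<lambda>k. ?w (n + k)))", OF this]
  have "wfrob (wlim ?w) = wlim (\<lambda>n. wfrob (?w n))"
    by simp
  then show ?thesis
    unfolding psum_def by (subst wlim_unfold) (simp add: of_nat_CHAR_mult_witt[OF assms])
qed

lemma psum_unique:
  fixes u z :: "nat \<Rightarrow> 'a::comm_ring_1 witt"
  assumes "prime CHAR('a)" and "\<And>n. u n = z n + of_nat CHAR('a) * u (Suc n)"
  shows "u 0 = psum z"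
proof -
  define d where "d n = u n - psum (\<lambda>k. z (n + k))" for n
  have d: "d n = of_nat CHAR('a) * d (Suc n)" for n
    unfolding d_def by (subst assms(2), subst psum_unfold[OF assms(1)]) (simp add: algebra_simps)
  have "wlow k (d n)" for k n
  proof (induction k arbitrary: n)
    case (Suc k)
    then show ?case by (subst d) (simp add: wlow_CHAR_mult assms(1))
  qed (simp add: wlow_def)
  from wlow_all_imp_0[OF this, of 0] show ?thesis by (simp add: d_def)
qed

lemma additive_of_nat_mult:
  fixes g :: "'a::comm_ring_1 \<Rightarrow> 'b::comm_ring_1"
  assumes "\<And>x y. g (x + y) = g x + g y"
  shows "g (of_nat n * x) = of_nat n * g x"
proof (induction n)
  case 0
  show ?case using assms[of 0 0] by simp
qed (simp add: distrib_right assms)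

text \<open>An additive map commutes with multiplication by p, so the images of the tails satisfy
  the recursion that characterises \<open>psum\<close>.\<close>

lemma psum_additive:
  fixes g :: "'a::comm_ring_1 witt \<Rightarrow> 'b::comm_ring_1 witt"
  assumes "prime CHAR('a)" and "CHAR('a) = CHAR('b)" and g: "\<And>x y. g (x + y) = g x + g y"
  shows "g (psum z) = psum (\<lambda>n. g (z n))"
proof -
  have "g (psum (\<lambda>k. z (n + k))) = g (z n) + of_nat CHAR('b) * g (psum (\<lambda>k. z (Suc n + k)))" for n
    by (subst psum_unfold[OF assms(1)]) (simp add: g additive_of_nat_mult assms(2))
  from psum_unique[of "\<lambda>n. g (psum (\<lambda>k. z (n + k)))", OF _ this] show ?thesis
    using assms(1,2) by simp
qed

lemma psum_add:
  fixes z w :: "nat \<Rightarrow> 'a::comm_ring_1 witt"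
  assumes "prime CHAR('a)"
  shows "psum (\<lambda>n. z n + w n) = psum z + psum w"
proof -
  have "psum (\<lambda>k. z (n + k)) + psum (\<lambda>k. w (n + k)) = (z n + w n) +
      of_nat CHAR('a) * (psum (\<lambda>k. z (Suc n + k)) + psum (\<lambda>k. w (Suc n + k)))" for n
    by (subst (1 2) psum_unfold[OF assms]) (simp add: algebra_simps)
  from psum_unique[of "\<lambda>n. psum (\<lambda>k. z (n + k)) + psum (\<lambda>k. w (n + k))", OF assms this]
  show ?thesis by simp
qed

lemma psum_sum:
  fixes z :: "'i \<Rightarrow> nat \<Rightarrow> 'a::comm_ring_1 witt"
  assumes "prime CHAR('a)"
  shows "psum (\<lambda>n. \<Sum>i\<in>A. z i n) = (\<Sum>i\<in>A. psum (z i))"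
proof (induction A rule: infinite_finite_induct)
  have "psum (\<lambda>n. 0 :: 'a witt) = 0"
    using psum_unique[of "\<lambda>_. 0" "\<lambda>_. 0 :: 'a witt"] assms by simp
  then show "psum (\<lambda>n. \<Sum>i\<in>A. z i n) = (\<Sum>i\<in>A. psum (z i))" if "infinite A" for A
    using that by simp
  show "psum (\<lambda>n. \<Sum>i\<in>{}. z i n) = (\<Sum>i\<in>{}. psum (z i))"
    using \<open>psum (\<lambda>n. 0) = 0\<close> by simp
qed (simp add: psum_add[OF assms])

lemma psum_drop:
  fixes z :: "nat \<Rightarrow> 'a::comm_ring_1 witt"
  assumes "prime CHAR('a)" and "\<And>j. j < n \<Longrightarrow> z j = 0"
  shows "psum z = of_nat (CHAR('a) ^ n) * psum (\<lambda>k. z (n + k))"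
  using assms(2)
proof (induction n)
  case (Suc n)
  then have "psum z = of_nat (CHAR('a) ^ n) * psum (\<lambda>k. z (n + k))"
    by simp
  also have "psum (\<lambda>k. z (n + k)) = of_nat CHAR('a) * psum (\<lambda>k. z (Suc n + k))"
    by (subst psum_unfold[OF assms(1)]) (simp add: Suc.prems)
  finally show ?case by (simp add: mult_ac)
qed simp

lemma wlow_CHAR_power_mult:
  assumes "prime CHAR('a)"
  shows "wlow n (of_nat (CHAR('a) ^ n) * (x :: 'a::comm_ring_1 witt))"
proof (induction n)
  case (Suc n)
  from wlow_CHAR_mult[OF assms this] show ?case by (simp add: mult.assoc)
qed (simp add: wlow_def)


section \<open>The Artin--Schreier--Witt map\<close>

definition wAS :: "'a::comm_ring_1 witt \<Rightarrow> 'a witt" where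
  "wAS x = wfrob x - x"

context
  fixes ty :: "'a::comm_ring_1 itself"
  assumes prime_CHAR: "prime CHAR('a)"
begin

interpretation wfrob: comm_ring_hom "wfrob :: 'a witt \<Rightarrow> 'a witt"
  by (rule comm_ring_hom_wfrob[OF prime_CHAR])

lemma wAS_add: "wAS (x + y :: 'a witt) = wAS x + wAS y"
  by (simp add: wAS_def wfrob.hom_add)

lemma wAS_diff: "wAS (x - y :: 'a witt) = wAS x - wAS y"
  by (simp add: wAS_def wfrob.hom_diff)

lemma wAS_uminus: "wAS (- y :: 'a witt) = - wAS y"
  by (simp add: wAS_def wfrob.hom_uminus)

lemma wAS_wver: "wAS (wver x :: 'a witt) = wver (wAS x)"
  by (simp add: wAS_def wver_diff wfrob_wver[OF prime_CHAR])

lemma wAS_wver': "wAS (wver x :: 'a witt) = of_nat CHAR('a) * x - wver x"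
  by (simp add: wAS_def of_nat_CHAR_mult_witt[OF prime_CHAR] wfrob_wver[OF prime_CHAR])

lemma range_wAS_add: "x \<in> range wAS \<Longrightarrow> y \<in> range wAS \<Longrightarrow> x + y \<in> range (wAS :: 'a witt \<Rightarrow> _)"
  by (auto simp flip: wAS_add)

lemma range_wAS_diff: "x \<in> range wAS \<Longrightarrow> y \<in> range wAS \<Longrightarrow> x - y \<in> range (wAS :: 'a witt \<Rightarrow> _)"
  by (auto simp flip: wAS_diff)

text \<open>In the step, \<open>p V^n x - V^(n+1) x\<close> is the image of
  \<open>V (V^n x)\<close>, and p times the previous difference stays in the range by
  additivity.\<close>

lemma range_wAS_wver_funpow:
  "of_nat (CHAR('a) ^ n) * x - (wver ^^ n) x \<in> range (wAS :: 'a witt \<Rightarrow> _)"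
proof (induction n)
  case (Suc n)
  have "(of_nat CHAR('a) * of_nat (CHAR('a) ^ n) * x - of_nat CHAR('a) * (wver ^^ n) x) +
      (of_nat CHAR('a) * (wver ^^ n) x - wver ((wver ^^ n) x)) \<in> range wAS"
  proof (rule range_wAS_add)
    from Suc obtain y where "of_nat (CHAR('a) ^ n) * x - (wver ^^ n) x = wAS y" by auto
    then have "of_nat CHAR('a) * of_nat (CHAR('a) ^ n) * x - of_nat CHAR('a) * (wver ^^ n) x =
        wAS (of_nat CHAR('a) * y)"
      by (simp add: additive_of_nat_mult wAS_add mult.assoc flip: right_diff_distrib)
    then show "of_nat CHAR('a) * of_nat (CHAR('a) ^ n) * x - of_nat CHAR('a) * (wver ^^ n) x
        \<in> range wAS"
      by simp
  qed (auto simp flip: wAS_wver')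
  then show ?case by simp
next
  case 0
  have "wAS 0 = (0 :: 'a witt)" using wAS_diff[of 0 0] by simp
  then show ?case by (metis diff_self funpow_0 mult_1 of_nat_1 power_0 rangeI)
qed

text \<open>With w the tail of \<open>x - y\<close>, one has \<open>x - y = V w\<close> and
  \<open>wAS (- V w) = V w - p w\<close>. This drives every p-adic approximation: once component 0
  is matched, what remains is an element of the range and a multiple of p.\<close>

lemma exists_wAS_of_coeff_0:
  assumes "wnth x 0 = (wnth y 0 :: 'a)"
  shows "\<exists>x' Y. x = y + wAS Y + of_nat CHAR('a) * x'"
proof -
  have "x - y = wver (wtl (x - y))"
    by (rule wver_wtl[symmetric]) (simp add: wnth_0.hom_diff assms)
  then have "x = y + wAS (- wver (wtl (x - y))) + of_nat CHAR('a) * wtl (x - y)"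
    unfolding wAS_uminus wAS_wver' by simp
  then show ?thesis by blast
qed

text \<open>If \<open>p x = F Y - Y\<close>, then y = \<open>wnth Y 0\<close> satisfies
  \<open>y ^ p = y\<close>, so [y] is killed and Y may be replaced by V of its tail. Cancelling V
  leaves \<open>F x = wAS (wtl Y)\<close>; subtracting \<open>F x - x\<close> gives the witness
  \<open>wtl Y - x\<close>.\<close>

lemma range_wAS_divide_CHAR:
  assumes "\<And>a::'a. a ^ CHAR('a) = 0 \<Longrightarrow> a = 0"
    and "of_nat CHAR('a) * x \<in> range (wAS :: 'a witt \<Rightarrow> _)"
  shows "x \<in> range (wAS :: 'a witt \<Rightarrow> _)"
proof -
  from assms(2) obtain Y where Y: "of_nat CHAR('a) * x = wAS Y" by auto
  have "wnth (wAS Y) 0 = 0"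
    unfolding Y[symmetric] by (simp add: of_nat_CHAR_mult_witt[OF prime_CHAR])
  then have "wAS (wteich (wnth Y 0)) = 0"
    by (simp add: wAS_def wfrob_wteich[OF prime_CHAR] wnth_0.hom_diff)
  then have "wver (wfrob x) = wver (wAS (wtl Y))"
    using Y wteich_wver_decomp[of Y]
    by (metis add_0 of_nat_CHAR_mult_witt[OF prime_CHAR] wAS_add wAS_wver)
  then have "x = wAS (wtl Y - x)"
    by (simp add: wAS_diff) (simp add: wAS_def)
  then show ?thesis by blast
qed

end

lemma CHAR_mult_witt_eq_0:
  fixes x :: "'a::comm_ring_1 witt"
  assumes "prime CHAR('a)" "\<And>a::'a. a ^ CHAR('a) = 0 \<Longrightarrow> a = 0" "of_nat CHAR('a) * x = 0"
  shows "x = 0"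
proof (rule witt_eqI)
  fix n
  have "wver (wfrob x) = wver 0"
    using assms(3) by (simp add: of_nat_CHAR_mult_witt[OF assms(1)])
  then have "wnth (wfrob x) n = wnth 0 n" by (simp only: wver_eq_iff)
  then show "wnth x n = wnth 0 n" by (simp add: assms(2))
qed

lemma map_witt_wAS:
  fixes h :: "'a::comm_ring_1 \<Rightarrow> 'b::comm_ring_1"
  assumes "comm_ring_hom h" and "CHAR('a) = CHAR('b)"
  shows "map_witt h (wAS x) = wAS (map_witt h x)"
  by (simp add: wAS_def comm_ring_hom.hom_diff[OF comm_ring_hom_map_witt[OF assms]]
      map_witt_wfrob[OF assms])


section \<open>Finite fields\<close>

lemma prime_CHAR_finite: "prime CHAR('k::{field,finite})"
  using prime_CHAR_semidom finite_imp_CHAR_pos[where 'a = 'k] by auto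

text \<open>The polynomial \<open>X^p - X - w\<close> has degree p. The bound serves both the fixed
  points of Frobenius and the fibres of the Artin-Schreier map.\<close>

lemma card_roots_le:
  fixes w :: "'k::{field,finite}"
  shows "card {x. x ^ CHAR('k) - x = w} \<le> CHAR('k)"
proof -
  let ?p = "CHAR('k)"
  let ?f = "monom 1 ?p - monom 1 1 - [:w:] :: 'k poly"
  have p: "1 < ?p" using prime_gt_1_nat[OF prime_CHAR_finite] .
  have deg: "degree ?f \<le> ?p"
    using p by (intro degree_diff_le) (auto intro: order_trans[OF degree_monom_le])
  have "coeff ?f ?p = 1"
    using p by (simp add: coeff_pCons split: nat.split)
  then have "?f \<noteq> 0" by (metis coeff_0 zero_neq_one)
  from card_poly_roots_bound[OF this] deg have "card {x. poly ?f x = 0} \<le> ?p" by simp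
  moreover have "{x. poly ?f x = 0} = {x. x ^ ?p - x = w}"
    by (simp add: poly_monom)
  ultimately show ?thesis by simp
qed

lemma of_int_power_CHAR: "(of_int n :: 'k::{field,finite}) ^ CHAR('k) = of_int n"
proof -
  interpret comm_ring_hom "\<lambda>a::'k. a ^ CHAR('k)"
    by (rule comm_ring_hom_power_CHAR[OF prime_CHAR_finite])
  show ?thesis by (rule hom_of_int)
qed

lemma inj_on_of_nat_CHAR: "inj_on (of_nat :: nat \<Rightarrow> 'k::{field,finite}) {..<CHAR('k)}"
proof (rule linorder_inj_onI)
  fix x y assume xy: "x < y" "x \<in> {..<CHAR('k)}" "y \<in> {..<CHAR('k)}"
  show "of_nat x \<noteq> (of_nat y :: 'k)"
  proof
    assume "of_nat x = (of_nat y :: 'k)"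
    then have "of_nat (y - x) = (0 :: 'k)" using xy by (simp add: of_nat_diff)
    then have "CHAR('k) dvd y - x" by (simp add: of_nat_eq_0_iff_char_dvd)
    then show False using xy by (auto dest: dvd_imp_le)
  qed
qed auto

lemma of_nat_image_subset_fixed:
  "of_nat ` {..<CHAR('k)} \<subseteq> {x::'k::{field,finite}. x ^ CHAR('k) - x = 0}"
  using of_int_power_CHAR[where 'k = 'k, of "int _"] by auto

text \<open>The multiples of 1 already supply p roots of \<open>X^p - X\<close>, and there are no
  more.\<close>

lemma prime_subfield_iff: "(c::'k::{field,finite}) \<in> prime_subfield \<longleftrightarrow> c ^ CHAR('k) = c"
proof
  assume "c ^ CHAR('k) = c"
  have "of_nat ` {..<CHAR('k)} = {x::'k. x ^ CHAR('k) - x = 0}"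
    using card_roots_le[of "0::'k"] of_nat_image_subset_fixed[where 'k = 'k]
    by (intro card_seteq) (auto simp: card_image[OF inj_on_of_nat_CHAR])
  with \<open>c ^ CHAR('k) = c\<close> obtain n where "c = of_nat n" by auto
  then have "c = of_int (int n)" by simp
  then show "c \<in> prime_subfield" unfolding prime_subfield_def by blast
qed (auto simp: prime_subfield_def of_int_power_CHAR)

lemma inj_power_CHAR: "inj (\<lambda>a::'k::{field,finite}. a ^ CHAR('k))"
proof -
  interpret comm_ring_hom "\<lambda>a::'k. a ^ CHAR('k)"
    by (rule comm_ring_hom_power_CHAR[OF prime_CHAR_finite])
  show ?thesis
    using hom_diff by (intro injI) (metis eq_iff_diff_eq_0 power_eq_0_iff)
qed

lemma surj_power_CHAR: "surj (\<lambda>a::'k::{field,finite}. a ^ CHAR('k))"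
  by (rule finite_UNIV_inj_surj[OF _ inj_power_CHAR]) simp

text \<open>Composition with Frobenius permutes the Galois group, so it only reorders the
  sum.\<close>

lemma field_trace_power_CHAR: "field_trace ((b::'k::{field,finite}) ^ CHAR('k)) = field_trace b"
proof -
  let ?\<phi> = "\<lambda>a::'k. a ^ CHAR('k)"
  interpret comm_ring_hom ?\<phi>
    by (rule comm_ring_hom_power_CHAR[OF prime_CHAR_finite])
  have sub: "(\<lambda>\<sigma>. \<sigma> \<circ> ?\<phi>) ` galois_group \<subseteq> galois_group"
    using bij_betw_def[of ?\<phi> UNIV UNIV] inj_power_CHAR[where 'k = 'k] surj_power_CHAR[where 'k = 'k]
    by (auto simp: galois_group_def hom_add hom_mult prime_subfield_iff[THEN iffD1] intro!: bij_comp)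
  have inj: "inj_on (\<lambda>\<sigma>. \<sigma> \<circ> ?\<phi>) galois_group"
  proof (rule inj_onI)
    fix \<sigma> \<tau> :: "'k \<Rightarrow> 'k" assume "\<sigma> \<circ> ?\<phi> = \<tau> \<circ> ?\<phi>"
    then show "\<sigma> = \<tau>" using surj_power_CHAR by (metis surj_fun_eq)
  qed
  have "bij_betw (\<lambda>\<sigma>. \<sigma> \<circ> ?\<phi>) galois_group galois_group"
    using endo_inj_surj[OF _ sub inj] inj by (simp add: bij_betw_def)
  from sum.reindex_bij_betw[OF this, of "\<lambda>\<sigma>. \<sigma> b"] show ?thesis
    by (simp add: field_trace_def)
qed

lemma field_trace_diff: "field_trace (a - b) = field_trace a - field_trace (b::'k::{field,finite})"
proof -
  have "\<sigma> (a - b) = \<sigma> a - \<sigma> b" if "\<sigma> \<in> galois_group" for \<sigma> :: "'k \<Rightarrow> 'k"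
  proof -
    have "\<sigma> (a - b) + \<sigma> b = \<sigma> (a - b + b)"
      using that unfolding galois_group_def by (metis (mono_tags, lifting) mem_Collect_eq)
    then show ?thesis by (simp add: eq_diff_eq)
  qed
  then have "field_trace (a - b) = (\<Sum>\<sigma>\<in>galois_group. \<sigma> a - \<sigma> b)"
    unfolding field_trace_def by (rule sum.cong[OF refl])
  then show ?thesis by (simp add: field_trace_def sum_subtractf)
qed

text \<open>Frobenius fixes c, so dividing by a nonzero c would put \<alpha> into the form
  \<open>b ^ p - b\<close>, whose trace is 0.\<close>

lemma prime_subfield_mult_eq_0:
  fixes \<alpha> :: "'k::{field,finite}"
  assumes "field_trace \<alpha> \<noteq> 0" and "c \<in> prime_subfield" and "c * \<alpha> = b ^ CHAR('k) - b"
  shows "c = 0"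
proof (rule ccontr)
  assume "c \<noteq> 0"
  have "(b / c) ^ CHAR('k) - b / c = \<alpha>"
    using assms(2,3) \<open>c \<noteq> 0\<close>
    by (simp add: power_divide prime_subfield_iff flip: diff_divide_distrib) (metis nonzero_mult_div_cancel_left)
  then show False
    using assms(1) field_trace_diff[of "(b / c) ^ CHAR('k)" "b / c"] field_trace_power_CHAR[of "b / c"]
    by simp
qed

lemma prime_subfield_diff:
  "a \<in> prime_subfield \<Longrightarrow> b \<in> prime_subfield \<Longrightarrow> a - b \<in> (prime_subfield :: 'a::ring_1 set)"
  by (auto simp: prime_subfield_def simp flip: of_int_diff)

text \<open>Fibres of the Artin-Schreier map have at most p elements, so its range has at least
  |k|/p. The p multiples of \<alpha> by prime field elements translate the range into disjoint
  cosets, which must therefore cover k.\<close>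

lemma finite_field_AS_decomp:
  fixes \<alpha> :: "'k::{field,finite}"
  assumes "field_trace \<alpha> \<noteq> 0"
  obtains c b where "c \<in> prime_subfield" "a = c * \<alpha> + (b ^ CHAR('k) - b)"
proof -
  let ?p = "CHAR('k)"
  let ?AS = "\<lambda>b::'k. b ^ ?p - b"
  interpret comm_ring_hom "\<lambda>a::'k. a ^ ?p"
    by (rule comm_ring_hom_power_CHAR[OF prime_CHAR_finite])
  have "card (UNIV :: 'k set) = card (\<Union>w\<in>range ?AS. {x. ?AS x = w})"
    by (rule arg_cong[of _ _ card]) auto
  also have "\<dots> \<le> (\<Sum>w\<in>range ?AS. card {x. ?AS x = w})"
    by (rule card_UN_le) simp
  also have "\<dots> \<le> (\<Sum>w\<in>range ?AS. ?p)"
    by (intro sum_mono card_roots_le)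
  finally have le: "card (UNIV :: 'k set) \<le> ?p * card (range ?AS)"
    by (simp add: mult.commute)
  let ?g = "\<lambda>(c, w). c * \<alpha> + w"
  let ?S = "(of_nat ` {..<?p} :: 'k set) \<times> range ?AS"
  have pf: "of_nat n \<in> (prime_subfield :: 'k set)" for n
    unfolding prime_subfield_def by (metis of_int_of_nat_eq rangeI)
  have "inj_on ?g ?S"
  proof (rule inj_onI, clarify)
    fix m n :: nat and x y :: 'k
    assume eq: "of_nat m * \<alpha> + ?AS x = of_nat n * \<alpha> + ?AS y"
    then have "(of_nat m - of_nat n) * \<alpha> = (y - x) ^ ?p - (y - x)"
      by (simp add: hom_diff algebra_simps)
    then have "of_nat m - of_nat n = (0 :: 'k)"
      by (rule prime_subfield_mult_eq_0[OF assms prime_subfield_diff[OF pf pf]])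
    with eq show "of_nat m = (of_nat n :: 'k) \<and> ?AS x = ?AS y" by simp
  qed
  then have "card (?g ` ?S) = ?p * card (range ?AS)"
    by (simp add: card_image card_cartesian_product inj_on_of_nat_CHAR)
  with le have "?g ` ?S = UNIV"
    by (intro card_seteq) auto
  then have "a \<in> ?g ` ?S" by simp
  then show ?thesis using that pf by auto
qed


unbundle fps_syntax

section \<open>The Artin--Schreier map on Laurent series\<close>

lemma comm_ring_hom_fls_const: "comm_ring_hom (fls_const :: 'a::comm_ring_1 \<Rightarrow> 'a fls)"
  by standard (simp_all add: fls_plus_const)

lemma comm_ring_hom_fps_to_fls: "comm_ring_hom (fps_to_fls :: 'a::comm_ring_1 fps \<Rightarrow> 'a fls)"
  by standard (simp_all add: fls_times_fps_to_fls)

lemma comm_ring_hom_fps_nth_0: "comm_ring_hom (\<lambda>f :: 'a::comm_ring_1 fps. fps_nth f 0)"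
  by standard simp_all

lemma fps_power_low_coeffs:
  fixes g :: "'a::comm_ring_1 fps"
  assumes "\<And>i. i < N \<Longrightarrow> fps_nth g i = 0" and "0 < n" and "i < N"
  shows "fps_nth (g ^ n) i = 0"
  using assms by (cases n) (auto simp: fps_mult_nth intro!: sum.neutral)

text \<open>The solution is \<open>- f - f ^ p - f ^ (p ^ 2) - \<dots>\<close>.\<close>

lemma fps_AS_solution:
  fixes f :: "'k::{field,finite} fps"
  assumes "fps_nth f 0 = 0"
  obtains y where "fps_nth y 0 = 0" "f = y ^ CHAR('k) - y"
proof -
  let ?p = "CHAR('k)"
  have p: "prime ?p" by (rule prime_CHAR_finite)
  interpret comm_ring_hom "\<lambda>a::'k fps. a ^ ?p"
    using comm_ring_hom_power_CHAR[where 'a = "'k fps"] p by simp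
  define Y where "Y N = - (\<Sum>j<N. f ^ (?p ^ j))" for N
  define y where "y = Abs_fps (\<lambda>n. fps_nth (Y (Suc n)) n)"
  have f_pow: "fps_nth (f ^ (?p ^ j)) i = 0" if "i \<le> j" for i j
  proof -
    have "j < ?p ^ j" using prime_gt_1_nat[OF p] by (simp add: power_gt_expt)
    then show ?thesis using startsby_zero_power_prefix[OF assms, of "?p ^ j"] that by simp
  qed
  have Y_AS: "Y N ^ ?p - Y N = f - f ^ (?p ^ N)" for N
  proof (induction N)
    case 0
    then show ?case by (simp add: Y_def hom_zero)
  next
    case (Suc N)
    have Y_Suc: "Y (Suc N) = Y N - f ^ (?p ^ N)" by (simp add: Y_def)
    then have "Y (Suc N) ^ ?p = Y N ^ ?p - f ^ (?p ^ Suc N)"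
      by (simp add: hom_diff mult.commute flip: power_mult)
    then have "Y (Suc N) ^ ?p - Y (Suc N) = (Y N ^ ?p - Y N) + f ^ (?p ^ N) - f ^ (?p ^ Suc N)"
      by (simp only: Y_Suc) simp
    then show ?case by (simp only: Suc.IH) simp
  qed
  have y_Y: "fps_nth y i = fps_nth (Y N) i" if "i < N" for i N
    using Suc_leI[OF that]
  proof (induction N rule: dec_induct)
    case (step N)
    then show ?case using f_pow[of i N] by (simp add: Y_def)
  qed (simp add: y_def)
  have "fps_nth f n = fps_nth (y ^ ?p - y) n" for n
  proof -
    let ?N = "Suc n"
    have low: "fps_nth (y - Y ?N) i = 0" if "i < ?N" for i
      using y_Y[OF that] by simp
    \<comment> \<open>The p-power map is additive, so agreement of the low coefficients of
      \<open>y\<close> and \<open>Y ?N\<close> passes to their p-th powers.\<close>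
    have "fps_nth ((y - Y ?N) ^ ?p) n = 0"
      by (rule fps_power_low_coeffs[OF low prime_gt_0_nat[OF p] lessI])
    then have "fps_nth (y ^ ?p) n = fps_nth (Y ?N ^ ?p) n"
      by (simp add: hom_diff)
    then have "fps_nth (y ^ ?p - y) n = fps_nth (Y ?N ^ ?p - Y ?N) n"
      using low[of n] by simp
    also have "\<dots> = fps_nth f n"
      unfolding Y_AS using f_pow[of n ?N] by simp
    finally show ?thesis by simp
  qed
  then have "f = y ^ ?p - y" by (rule fps_ext)
  moreover have "fps_nth y 0 = 0"
    using assms by (simp add: y_def Y_def)
  ultimately show ?thesis using that by blast
qed

lemma fls_AS_subdegree:
  fixes y :: "'k::{field,finite} fls"
  assumes "fls_subdegree (y ^ CHAR('k) - y) < 0"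
  shows "fls_subdegree y < 0" "int CHAR('k) dvd fls_subdegree (y ^ CHAR('k) - y)"
proof -
  let ?p = "CHAR('k)"
  interpret comm_ring_hom "fps_to_fls :: 'k fps \<Rightarrow> _"
    by (rule comm_ring_hom_fps_to_fls)
  show neg: "fls_subdegree y < 0"
  proof (rule ccontr)
    assume "\<not> fls_subdegree y < 0"
    then have "fps_to_fls (fls_regpart y) = y" by simp
    then have "y ^ ?p - y = fps_to_fls (fls_regpart y ^ ?p - fls_regpart y)"
      by (simp add: hom_diff hom_power)
    with assms show False by (metis fls_subdegree_fls_to_fps_gt0 not_less)
  qed
  then have "y \<noteq> 0" by auto
  \<comment> \<open>At a pole, \<open>y ^ p\<close> has strictly larger pole order than y, so its
    leading term cannot cancel.\<close>
  have "int ?p * fls_subdegree y < 1 * fls_subdegree y"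
    using neg prime_gt_1_nat[OF prime_CHAR_finite[where 'k = 'k]]
    by (intro mult_strict_right_mono_neg) auto
  then have "fls_subdegree (y ^ ?p) < fls_subdegree y"
    by (simp add: fls_subdegree_pow)
  then have "fls_subdegree (y ^ ?p - y) = fls_subdegree (y ^ ?p)"
    using \<open>y \<noteq> 0\<close> by (intro fls_subdegree_diff_eq1) auto
  then show "int ?p dvd fls_subdegree (y ^ ?p - y)"
    by (simp add: fls_subdegree_pow)
qed

lemma fls_const_add_AS_subdegree:
  fixes y :: "'k::{field,finite} fls"
  assumes "fls_subdegree (fls_const b + (y ^ CHAR('k) - y)) < 0"
  shows "int CHAR('k) dvd fls_subdegree (fls_const b + (y ^ CHAR('k) - y))"
proof -
  let ?f = "fls_const b + (y ^ CHAR('k) - y)"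
  have "?f \<noteq> 0" using assms by auto
  then have "fls_subdegree (?f - fls_const b) = fls_subdegree ?f"
    using assms by (intro fls_subdegree_diff_eq1) auto
  then show ?thesis
    using fls_AS_subdegree[of y] assms by simp
qed

text \<open>This is component 0 of a partial sum of Teichmueller terms.\<close>

definition polar_sum :: "'k::{field,finite} fls \<Rightarrow> nat \<Rightarrow> (nat \<Rightarrow> 'k) \<Rightarrow> 'k fls" where
  "polar_sum T M e = (\<Sum>i\<in>{i\<in>prime_to CHAR('k). i < M}. fls_const (e i) * inverse (T ^ i))"

lemma polar_sum_extend:
  assumes "\<And>i. M \<le> i \<Longrightarrow> e i = 0" and "M \<le> N"
  shows "polar_sum T M e = polar_sum T N e"
  unfolding polar_sum_def
  by (rule sum.mono_neutral_left) (use assms in auto)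

lemma polar_sum_add: "polar_sum T M (\<lambda>i. e i + f i) = polar_sum T M e + polar_sum T M f"
  by (simp add: polar_sum_def sum.distrib distrib_right flip: fls_plus_const)

definition AS_decomposable :: "'k::{field,finite} \<Rightarrow> 'k fls \<Rightarrow> 'k fls \<Rightarrow> bool" where
  "AS_decomposable \<alpha> T a \<longleftrightarrow> (\<exists>c e M y. c \<in> prime_subfield \<and> (\<forall>i\<ge>M. e i = 0) \<and>
     a = fls_const (c * \<alpha>) + polar_sum T M e + (y ^ CHAR('k) - y))"

lemma prime_subfield_add:
  "a \<in> prime_subfield \<Longrightarrow> b \<in> prime_subfield \<Longrightarrow> a + b \<in> (prime_subfield :: 'a::ring_1 set)"
  by (auto simp: prime_subfield_def simp flip: of_int_add)

lemma prime_subfield_0 [simp]: "0 \<in> (prime_subfield :: 'a::ring_1 set)"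
  unfolding prime_subfield_def by (metis of_int_0 rangeI)

lemma AS_decomposable_add:
  fixes \<alpha> :: "'k::{field,finite}"
  assumes "AS_decomposable \<alpha> T a" "AS_decomposable \<alpha> T b"
  shows "AS_decomposable \<alpha> T (a + b)"
proof -
  interpret comm_ring_hom "\<lambda>a::'k fls. a ^ CHAR('k)"
    using comm_ring_hom_power_CHAR[where 'a = "'k fls"] prime_CHAR_finite[where 'k = 'k] by simp
  from assms obtain c e M y d f N z where *: "c \<in> prime_subfield" "\<And>i. i \<ge> M \<Longrightarrow> e i = 0"
      "a = fls_const (c * \<alpha>) + polar_sum T M e + (y ^ CHAR('k) - y)"
      "d \<in> prime_subfield" "\<And>i. i \<ge> N \<Longrightarrow> f i = 0"
      "b = fls_const (d * \<alpha>) + polar_sum T N f + (z ^ CHAR('k) - z)"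
    unfolding AS_decomposable_def by blast
  have "a + b = fls_const ((c + d) * \<alpha>) + polar_sum T (max M N) (\<lambda>i. e i + f i) +
      ((y + z) ^ CHAR('k) - (y + z))"
    unfolding polar_sum_add hom_add *(3,6)
    using polar_sum_extend[of M e "max M N" T] polar_sum_extend[of N f "max M N" T] *(2,5)
    by (simp add: algebra_simps flip: fls_plus_const)
  with * show ?thesis
    unfolding AS_decomposable_def
    by (intro exI[of _ "c + d"] exI[of _ "\<lambda>i. e i + f i"] exI[of _ "max M N"] exI[of _ "y + z"])
       (auto intro: prime_subfield_add)
qed

lemma AS_decomposable_AS: "AS_decomposable \<alpha> T (y ^ CHAR('k) - y :: 'k::{field,finite} fls)"
  unfolding AS_decomposable_def
  by (intro exI[of _ 0] exI[of _ "\<lambda>_. 0"] exI[of _ y]) (simp add: polar_sum_def)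

lemma AS_decomposable_monomial:
  assumes "m \<in> prime_to CHAR('k)"
  shows "AS_decomposable \<alpha> T (fls_const u * inverse (T ^ m) :: 'k::{field,finite} fls)"
proof -
  have "polar_sum T (Suc m) (\<lambda>i. if i = m then u else 0) = fls_const u * inverse (T ^ m)"
  proof -
    have "polar_sum T (Suc m) (\<lambda>i. if i = m then u else 0) =
        (\<Sum>i\<in>{m}. fls_const (if i = m then u else 0) * inverse (T ^ i))"
      unfolding polar_sum_def by (rule sum.mono_neutral_right) (use assms in auto)
    then show ?thesis by simp
  qed
  moreover have "(0::'k fls) ^ CHAR('k) = 0"
    using prime_gt_0_nat[OF prime_CHAR_finite[where 'k = 'k]] by (simp add: zero_power)
  ultimately show ?thesis
    unfolding AS_decomposable_def
    by (intro exI[of _ 0] exI[of _ "\<lambda>i. if i = m then u else 0"] exI[of _ "Suc m"]) auto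
qed

text \<open>The part without constant term lies in the range by \<open>fps_AS_solution\<close>; the
  constant term is split inside k.\<close>

lemma AS_decomposable_integral:
  fixes \<alpha> :: "'k::{field,finite}"
  assumes "field_trace \<alpha> \<noteq> 0" and "fls_subdegree a \<ge> 0"
  shows "AS_decomposable \<alpha> T a"
proof -
  let ?p = "CHAR('k)"
  interpret comm_ring_hom "fps_to_fls :: 'k fps \<Rightarrow> _" by (rule comm_ring_hom_fps_to_fls)
  interpret fc: comm_ring_hom "fls_const :: 'k \<Rightarrow> _" by (rule comm_ring_hom_fls_const)
  define f where "f = fls_regpart a"
  have a: "a = fps_to_fls f" using assms(2) by (simp add: f_def)
  obtain y where y: "f - fps_const (fps_nth f 0) = y ^ ?p - y"
    using fps_AS_solution[of "f - fps_const (fps_nth f 0)"] by auto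
  obtain c b where cb: "c \<in> prime_subfield" "fps_nth f 0 = c * \<alpha> + (b ^ ?p - b)"
    using finite_field_AS_decomp[OF assms(1)] .
  have "a = fps_to_fls (f - fps_const (fps_nth f 0)) + fls_const (fps_nth f 0)"
    unfolding a hom_diff by simp
  also have "\<dots> = (fps_to_fls y ^ ?p - fps_to_fls y) + (fls_const b ^ ?p - fls_const b) + fls_const (c * \<alpha>)"
  proof -
    have "fls_const (fps_nth f 0) = fls_const (c * \<alpha>) + (fls_const b ^ ?p - fls_const b)"
      by (simp only: cb(2) fc.hom_add fc.hom_diff fc.hom_power)
    moreover have "fps_to_fls (f - fps_const (fps_nth f 0)) = fps_to_fls y ^ ?p - fps_to_fls y"
      by (simp only: y hom_diff hom_power)
    ultimately show ?thesis by (simp only: add_ac)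
  qed
  finally have "a = (fps_to_fls y ^ ?p - fps_to_fls y) + (fls_const b ^ ?p - fls_const b) + fls_const (c * \<alpha>)" .
  moreover have "AS_decomposable \<alpha> T (fls_const (c * \<alpha>))"
    unfolding AS_decomposable_def using cb(1) prime_gt_0_nat[OF prime_CHAR_finite[where 'k = 'k]]
    by (intro exI[of _ c] exI[of _ "\<lambda>_. 0"] exI[of _ 0]) (simp add: polar_sum_def zero_power)
  ultimately show ?thesis
    by (simp add: AS_decomposable_add AS_decomposable_AS)
qed

lemma AS_decomposable:
  fixes \<alpha> :: "'k::{field,finite}"
  assumes "field_trace \<alpha> \<noteq> 0" and T: "fls_subdegree T = 1"
  shows "AS_decomposable \<alpha> T a"
proof -
  let ?p = "CHAR('k)"
  have p: "prime ?p" by (rule prime_CHAR_finite)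
  have "\<forall>i. i < - int N \<longrightarrow> a $$ i = 0 \<Longrightarrow> AS_decomposable \<alpha> T a" for N
  proof (induction N arbitrary: a)
    case 0
    then show ?case
      by (intro AS_decomposable_integral assms fls_subdegree_ge0I) simp
  next
    case (Suc N)
    let ?m = "Suc N"
    define t where "t i = inverse (T ^ i)" for i
    have sub: "fls_subdegree (t i) = - int i" for i
      by (simp add: t_def fls_subdegree_pow T)
    have "T \<noteq> 0" using T by auto
    then have "t ?m \<noteq> 0" by (simp add: t_def)
    then have lead: "t ?m $$ (- int ?m) \<noteq> 0"
      using nth_fls_subdegree_nonzero[of "t ?m"] unfolding sub by simp
    \<comment> \<open>T is an arbitrary uniformizer, so \<open>t ?m\<close> may have further
      coefficients; u only cancels the one of lowest degree.\<close>
    define u where "u = a $$ (- int ?m) / t ?m $$ (- int ?m)"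
    have "AS_decomposable \<alpha> T (a - fls_const u * t ?m)"
    proof (rule Suc.IH, intro allI impI)
      fix i assume "i < - int N"
      then consider "i = - int ?m" | "i < - int ?m" by force
      then show "(a - fls_const u * t ?m) $$ i = 0"
      proof cases
        case 1
        then show ?thesis using lead by (simp add: u_def)
      next
        case 2
        then show ?thesis using Suc.prems sub[of ?m] by simp
      qed
    qed
    moreover have "AS_decomposable \<alpha> T (fls_const u * t ?m)"
    proof (cases "?p dvd ?m")
      case False
      then have "?m \<in> prime_to ?p"
        using p by (simp add: prime_to_def prime_imp_coprime coprime_commute)
      then show ?thesis unfolding t_def by (rule AS_decomposable_monomial)
    next
      case True
      then obtain m' where m': "?m = ?p * m'" by (rule dvdE)
      obtain w where w: "u = w ^ ?p" using surj_power_CHAR[where 'k = 'k] by (metis surjE)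
      \<comment> \<open>The polar term becomes \<open>z ^ p = (z ^ p - z) + z\<close>, and z has
        pole order at most m' < m, so the induction hypothesis covers it.\<close>
      define z where "z = fls_const w * t m'"
      have z: "fls_const u * t ?m = z ^ ?p"
        unfolding z_def w t_def m'
        by (simp add: power_mult_distrib fls_const_power power_inverse mult.commute flip: power_mult)
      have "0 < m'" using m' by (cases m') auto
      then have "m' < ?m" using m' prime_gt_1_nat[OF p] by simp
      have "AS_decomposable \<alpha> T z"
      proof (rule Suc.IH, intro allI impI)
        fix i assume "i < - int N"
        then have "i < fls_subdegree (t m')" using \<open>m' < ?m\<close> by (simp add: sub)
        then show "z $$ i = 0" by (simp add: z_def)
      qed
      then have "AS_decomposable \<alpha> T ((z ^ ?p - z) + z)"
        by (intro AS_decomposable_add AS_decomposable_AS)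
      then show ?thesis by (simp add: z)
    qed
    ultimately have "AS_decomposable \<alpha> T ((a - fls_const u * t ?m) + fls_const u * t ?m)"
      by (rule AS_decomposable_add)
    then show ?case by simp
  qed
  from this[of "nat (- fls_subdegree a)"] show ?thesis
    by simp
qed

text \<open>Distinct exponents prevent cancellation of leading terms, so the largest exponent with
  nonzero coefficient is the pole order. It is prime to p, contrary to the divisibility for
  \<open>y ^ p - y\<close>.\<close>

lemma polar_sum_eq_AS_imp_0:
  fixes y :: "'k::{field,finite} fls"
  assumes T: "fls_subdegree T = 1"
    and eq: "fls_const b + polar_sum T M e = y ^ CHAR('k) - y"
    and i: "i \<in> prime_to CHAR('k)" "i < M"
  shows "e i = 0"
proof (rule ccontr)
  let ?p = "CHAR('k)"
  let ?I = "{i\<in>prime_to ?p. i < M}"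
  define t where "t i = inverse (T ^ i)" for i
  have sub: "fls_subdegree (t i) = - int i" for i
    by (simp add: t_def fls_subdegree_pow T)
  have "T \<noteq> 0" using T by auto
  then have "t i \<noteq> 0" for i by (simp add: t_def)
  then have lead: "t i $$ (- int i) \<noteq> 0" for i
    using nth_fls_subdegree_nonzero[of "t i"] unfolding sub by simp
  let ?E = "{i\<in>?I. e i \<noteq> 0}"
  define m where "m = Max ?E"
  assume "e i \<noteq> 0"
  then have "?E \<noteq> {}" "finite ?E" using i by auto
  then have m: "m \<in> ?E" and max: "\<And>i. i \<in> ?E \<Longrightarrow> i \<le> m"
    unfolding m_def using Max_in[of ?E] by auto
  then have "0 < m" by (simp add: prime_to_def)
  let ?f = "fls_const b + polar_sum T M e"
  have nth: "?f $$ n = (\<Sum>i\<in>?I. e i * t i $$ n)" if "n < 0" for n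
    using that by (simp add: polar_sum_def fls_nth_sum t_def)
  have zero: "e i * t i $$ n = 0" if "i \<in> ?I" "n < - int i \<or> m < i" for i n
    using that max[of i] sub[of i] by force
  have "?f $$ (- int m) = (\<Sum>i\<in>{m}. e i * t i $$ (- int m))"
    unfolding nth[OF neg_less_0_iff_less[THEN iffD2], OF of_nat_0_less_iff[THEN iffD2], OF \<open>0 < m\<close>]
    using m by (intro sum.mono_neutral_right ballI zero) auto
  also have "\<dots> \<noteq> 0" using m lead[of m] by simp
  finally have "?f $$ (- int m) \<noteq> 0" .
  moreover have "?f $$ n = 0" if "n < - int m" for n
  proof -
    have "(\<Sum>i\<in>?I. e i * t i $$ n) = 0"
      using that by (intro sum.neutral ballI zero) auto
    then show ?thesis using that nth[of n] by simp
  qed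
  ultimately have "fls_subdegree ?f = - int m" by (rule fls_subdegree_eqI)
  then have "int ?p dvd - int m"
    using fls_AS_subdegree(2)[of y] \<open>0 < m\<close> eq by simp
  then have "?p dvd m" by simp
  moreover have "coprime m ?p" using m by (simp add: prime_to_def)
  ultimately have "?p dvd 1" by (metis coprime_common_divisor dvd_refl)
  then show False using prime_gt_1_nat[OF prime_CHAR_finite[where 'k = 'k]] by simp
qed

text \<open>A solution in K cannot have a pole, so its constant term is a solution in k. This
  carries the trace obstruction from k to K.\<close>

lemma fls_const_eq_AS_imp:
  fixes y :: "'k::{field,finite} fls"
  assumes "fls_const b = y ^ CHAR('k) - y"
  obtains y0 where "b = y0 ^ CHAR('k) - y0"
proof -
  let ?p = "CHAR('k)"
  interpret comm_ring_hom "fps_to_fls :: 'k fps \<Rightarrow> _" by (rule comm_ring_hom_fps_to_fls)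
  have "\<not> fls_subdegree y < 0"
  proof
    assume neg: "fls_subdegree y < 0"
    then have "y \<noteq> 0" by auto
    have "int ?p * fls_subdegree y < 1 * fls_subdegree y"
      using neg prime_gt_1_nat[OF prime_CHAR_finite[where 'k = 'k]]
      by (intro mult_strict_right_mono_neg) auto
    then have "fls_subdegree (y ^ ?p - y) = fls_subdegree (y ^ ?p)"
      using \<open>y \<noteq> 0\<close> by (intro fls_subdegree_diff_eq1) (auto simp: fls_subdegree_pow)
    then have "0 = int ?p * fls_subdegree y"
      unfolding assms[symmetric] by (simp add: fls_subdegree_pow)
    then show False using neg prime_gt_0_nat[OF prime_CHAR_finite[where 'k = 'k]] by simp
  qed
  then have "fps_to_fls (fls_regpart y) = y" by simp
  then have "fps_to_fls (fps_const b) = fps_to_fls (fls_regpart y ^ ?p - fls_regpart y)"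
    using assms by (simp add: hom_diff hom_power)
  then have "fps_const b = fls_regpart y ^ ?p - fls_regpart y"
    by (simp only: fps_to_fls_eq_iff)
  then have "fps_nth (fps_const b) 0 = fps_nth (fls_regpart y ^ ?p - fls_regpart y) 0"
    by (rule arg_cong)
  then have "b = (fls_regpart y $ 0) ^ ?p - fls_regpart y $ 0"
    by (simp add: fps_power_zeroth)
  then show ?thesis by (rule that)
qed


section \<open>Integral Witt vectors\<close>

lemma wnth_wAS_0: "wnth (wAS x) 0 = wnth x 0 ^ CHAR('a) - wnth (x :: 'a::comm_ring_1 witt) 0"
  by (simp add: wAS_def wnth_0.hom_diff)

lemma wAS_wlim:
  fixes Y :: "nat \<Rightarrow> 'a::comm_ring_1 witt"
  assumes "prime CHAR('a)"
  shows "wAS (wlim Y) = wlim (\<lambda>n. wAS (Y n))"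
proof -
  have "wAS (wlim (\<lambda>k. Y (n + k))) = wAS (Y n) + wver (wAS (wlim (\<lambda>k. Y (Suc n + k))))" for n
    by (subst wlim_unfold) (simp add: wAS_add assms wAS_wver)
  from wlim_unique[of "\<lambda>n. wAS (wlim (\<lambda>k. Y (n + k)))", OF this] show ?thesis by simp
qed

text \<open>Component 0 is solved by a power series vanishing at 0; what is left is V of a vector of
  the same kind, and the solutions are summed V-adically.\<close>

lemma fps_witt_range_wAS:
  fixes Z :: "'k::{field,finite} fps witt"
  assumes "\<And>n. fps_nth (wnth Z n) 0 = 0"
  shows "Z \<in> range wAS"
proof -
  let ?p = "CHAR('k)"
  let ?\<epsilon> = "\<lambda>f :: 'k fps. fps_nth f 0"
  have pk: "prime CHAR('k)" by (rule prime_CHAR_finite)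
  then have pf: "prime CHAR('k fps)" by simp
  have hom\<epsilon>: "comm_ring_hom ?\<epsilon>" by (rule comm_ring_hom_fps_nth_0)
  interpret \<epsilon>: comm_ring_hom "map_witt ?\<epsilon> :: 'k fps witt \<Rightarrow> 'k witt"
    by (rule comm_ring_hom_map_witt[OF hom\<epsilon>]) simp
  \<comment> \<open>As the kernel of a ring homomorphism, the set is closed under subtraction
    although subtraction is not componentwise.\<close>
  let ?I = "{Z :: 'k fps witt. map_witt ?\<epsilon> Z = 0}"
  have step: "\<exists>Y Z'. Z = wAS Y + wver Z' \<and> Z' \<in> ?I" if "Z \<in> ?I" for Z
  proof -
    have "wnth (map_witt ?\<epsilon> Z) 0 = 0" using that by simp
    then obtain y where y: "fps_nth y 0 = 0" "wnth Z 0 = y ^ ?p - y"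
      using fps_AS_solution[of "wnth Z 0"] by auto
    define Z' where "Z' = wtl (Z - wAS (wteich y))"
    have "wver Z' = Z - wAS (wteich y)"
      unfolding Z'_def by (rule wver_wtl) (simp add: wnth_0.hom_diff wnth_wAS_0 y(2))
    moreover have "map_witt ?\<epsilon> (wver Z') = 0"
      unfolding \<open>wver Z' = _\<close> \<epsilon>.hom_diff
      using that y(1) by (simp add: map_witt_wAS[OF hom\<epsilon>] map_witt_wteich) (simp add: wAS_def wfrob_wteich[OF pk, of 0, simplified] zero_power prime_gt_0_nat[OF pk])
    then have "map_witt ?\<epsilon> Z' = 0"
      by (simp add: map_witt_wver) (metis wver_0 wver_eq_iff)
    ultimately show ?thesis by (intro exI[of _ "wteich y"] exI[of _ Z']) simp
  qed
  then obtain fY fZ where f: "\<And>Z. Z \<in> ?I \<Longrightarrow> Z = wAS (fY Z) + wver (fZ Z) \<and> fZ Z \<in> ?I"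
    by metis
  define u where "u n = (fZ ^^ n) Z" for n
  have "Z \<in> ?I" using assms by (auto intro: witt_eqI)
  then have "u n \<in> ?I" for n
    by (induction n) (use f in \<open>auto simp: u_def\<close>)
  with f have "u n = wAS (fY (u n)) + wver (u (Suc n))" for n
    by (simp add: u_def)
  from wlim_unique[of u, OF this] have "Z = wAS (wlim (\<lambda>n. fY (u n)))"
    by (simp add: wAS_wlim[OF pf]) (simp add: u_def)
  then show ?thesis by blast
qed

definition wconst :: "'k::comm_ring_1 witt \<Rightarrow> 'k fls witt" where
  "wconst = map_witt fls_const"

interpretation wconst: comm_ring_hom "wconst :: 'k::comm_ring_1 witt \<Rightarrow> _"
  unfolding wconst_def by (rule comm_ring_hom_map_witt[OF comm_ring_hom_fls_const]) simp

lemma wnth_wconst [simp]: "wnth (wconst c) n = fls_const (wnth c n)"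
  by (simp add: wconst_def)

lemma wconst_wAS: "wconst (wAS x) = wAS (wconst x)"
  unfolding wconst_def by (rule map_witt_wAS[OF comm_ring_hom_fls_const]) simp

text \<open>Stated as F-invariance, membership in W(F_p) is visibly stable under ring operations and
  under division by p.\<close>

lemma fixed_iff_prime_subfield:
  fixes c :: "'k::{field,finite} witt"
  shows "(\<forall>n. wnth c n \<in> prime_subfield) \<longleftrightarrow> wfrob c = c"
  by (auto simp: prime_subfield_iff intro: witt_eqI) (metis wnth_wfrob)

lemma wfrob_psum:
  fixes z :: "nat \<Rightarrow> 'a::comm_ring_1 witt"
  assumes "prime CHAR('a)"
  shows "wfrob (psum z) = psum (\<lambda>n. wfrob (z n))"
  by (rule psum_additive[OF assms refl]) (rule comm_ring_hom.hom_add[OF comm_ring_hom_wfrob[OF assms]])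

lemma psum_fixed:
  fixes c :: "nat \<Rightarrow> 'k::{field,finite}"
  assumes "\<And>n. c n \<in> prime_subfield"
  shows "wfrob (psum (\<lambda>n. wteich (c n))) = psum (\<lambda>n. wteich (c n))"
  using assms by (simp add: wfrob_psum wfrob_wteich prime_CHAR_finite prime_subfield_iff)

text \<open>The decomposition in k is applied digit by digit. The digits in the prime field are
  fixed by Frobenius, hence so is the p-adic sum of their Teichmueller lifts.\<close>

lemma finite_field_witt_decomp:
  fixes \<alpha> :: "'k::{field,finite}"
  assumes "field_trace \<alpha> \<noteq> 0"
  obtains c B where "wfrob c = c" "A = c * wteich \<alpha> + wAS B"
proof -
  have p: "prime CHAR('k)" by (rule prime_CHAR_finite)
  have "\<exists>c Y A'. c \<in> prime_subfield \<and>
      A = wteich c * wteich \<alpha> + wAS Y + of_nat CHAR('k) * A'" for A :: "'k witt"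
  proof -
    obtain c b where cb: "c \<in> prime_subfield" "wnth A 0 = c * \<alpha> + (b ^ CHAR('k) - b)"
      using finite_field_AS_decomp[OF assms] .
    have "wnth A 0 = wnth (wteich c * wteich \<alpha> + wAS (wteich b)) 0"
      by (simp add: cb(2) wnth_wAS_0)
    from exists_wAS_of_coeff_0[OF p this] obtain A' Y where
      "A = wteich c * wteich \<alpha> + wAS (wteich b) + wAS Y + of_nat CHAR('k) * A'" by blast
    then have "A = wteich c * wteich \<alpha> + wAS (wteich b + Y) + of_nat CHAR('k) * A'"
      by (simp add: wAS_add[OF p] add.assoc)
    with cb(1) show ?thesis by blast
  qed
  then obtain fc fY fA where f: "\<And>A. fc A \<in> prime_subfield"
    "\<And>A. A = wteich (fc A) * wteich \<alpha> + wAS (fY A) + of_nat CHAR('k) * fA A"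
    by metis
  define u where "u n = (fA ^^ n) A" for n
  have "u n = (wteich (fc (u n)) * wteich \<alpha> + wAS (fY (u n))) + of_nat CHAR('k) * u (Suc n)" for n
    using f(2)[of "u n"] by (simp add: u_def)
  from psum_unique[of u, OF p this]
  have "A = psum (\<lambda>n. wteich (fc (u n)) * wteich \<alpha>) + psum (\<lambda>n. wAS (fY (u n)))"
    by (simp add: psum_add[OF p]) (simp add: u_def)
  also have "psum (\<lambda>n. wteich (fc (u n)) * wteich \<alpha>) = psum (\<lambda>n. wteich (fc (u n))) * wteich \<alpha>"
    by (rule psum_additive[symmetric, OF p refl, of "\<lambda>x. x * wteich \<alpha>"]) (simp add: distrib_right)
  also have "psum (\<lambda>n. wAS (fY (u n))) = wAS (psum (\<lambda>n. fY (u n)))"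
    by (rule psum_additive[symmetric, OF p refl wAS_add[OF p]])
  finally show ?thesis
    using that psum_fixed[of "\<lambda>n. fc (u n)"] f(1) by blast
qed

lemma integral_witt_eq_map_fps:
  fixes X :: "'k::{field,finite} fls witt"
  assumes "\<And>n. fls_subdegree (wnth X n) \<ge> 0"
  shows "X = map_witt fps_to_fls (map_witt fls_regpart X)"
  by (rule witt_eqI) (simp add: assms)

lemma positive_witt_range_wAS:
  fixes X :: "'k::{field,finite} fls witt"
  assumes "\<And>n. fls_val (wnth X n) > 0"
  shows "X \<in> range wAS"
proof -
  have val: "fls_subdegree (wnth X n) > 0 \<or> wnth X n = 0" for n
    using assms[of n] by (auto simp: fls_val_def split: if_splits)
  then have "fls_subdegree (wnth X n) \<ge> 0" for n
    by (metis fls_zero_subdegree order.refl less_imp_le)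
  from integral_witt_eq_map_fps[OF this]
  have X: "X = map_witt fps_to_fls (map_witt fls_regpart X)" .
  have "fls_nth (wnth X n) 0 = 0" for n
    using val[of n] by auto
  then have "map_witt fls_regpart X \<in> range wAS"
    by (intro fps_witt_range_wAS) simp
  then obtain Y where "map_witt fls_regpart X = wAS Y" by auto
  with X have "X = wAS (map_witt fps_to_fls Y)"
    by (simp add: map_witt_wAS[OF comm_ring_hom_fps_to_fls])
  then show ?thesis by blast
qed

text \<open>Subtracting the reduction A at T = 0 leaves a vector over \<open>k[[T]]\<close> with
  vanishing constant terms, which lies in the range; A is then decomposed in W(k).\<close>

lemma integral_witt_decomp:
  fixes X :: "'k::{field,finite} fls witt"
  assumes "field_trace \<alpha> \<noteq> 0" and "\<And>n. fls_subdegree (wnth X n) \<ge> 0"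
  obtains c where "wfrob c = c" "X - wconst c * wconst (wteich \<alpha>) \<in> range wAS"
proof -
  let ?\<epsilon> = "\<lambda>f :: 'k fps. fps_nth f 0"
  have pk: "prime CHAR('k)" by (rule prime_CHAR_finite)
  interpret \<epsilon>: comm_ring_hom "map_witt ?\<epsilon> :: 'k fps witt \<Rightarrow> 'k witt"
    by (rule comm_ring_hom_map_witt[OF comm_ring_hom_fps_nth_0]) simp
  interpret \<iota>: comm_ring_hom "map_witt fps_to_fls :: 'k fps witt \<Rightarrow> 'k fls witt"
    by (rule comm_ring_hom_map_witt[OF comm_ring_hom_fps_to_fls]) simp
  define X' where "X' = map_witt fls_regpart X"
  have X: "X = map_witt fps_to_fls X'"
    unfolding X'_def by (rule integral_witt_eq_map_fps[OF assms(2)])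
  define A where "A = map_witt ?\<epsilon> X'"
  have "map_witt ?\<epsilon> (X' - map_witt fps_const A) = 0"
    by (simp add: \<epsilon>.hom_diff witt.map_comp comp_def A_def witt.map_ident)
  then have "wnth (map_witt ?\<epsilon> (X' - map_witt fps_const A)) n = 0" for n
    by simp
  then have "X' - map_witt fps_const A \<in> range wAS"
    by (intro fps_witt_range_wAS) simp
  then obtain Y where "X' - map_witt fps_const A = wAS Y" by auto
  then have "map_witt fps_to_fls X' - map_witt fps_to_fls (map_witt fps_const A) =
      map_witt fps_to_fls (wAS Y)"
    by (simp flip: \<iota>.hom_diff)
  then have XA: "X - wconst A = wAS (map_witt fps_to_fls Y)"
    by (simp add: X wconst_def witt.map_comp comp_def map_witt_wAS[OF comm_ring_hom_fps_to_fls])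
  obtain c B where c: "wfrob c = c" and A: "A = c * wteich \<alpha> + wAS B"
    using finite_field_witt_decomp[OF assms(1)] .
  have "X - wconst c * wconst (wteich \<alpha>) = (X - wconst A) + wconst (wAS B)"
    by (simp add: A wconst.hom_add wconst.hom_mult)
  also have "\<dots> \<in> range wAS"
    by (rule range_wAS_add) (use pk in \<open>auto simp: XA wconst_wAS\<close>)
  finally show ?thesis using c that by blast
qed


section \<open>Representatives modulo the Artin--Schreier--Witt map\<close>

definition wpartial :: "'k::{field,finite} fls \<Rightarrow> (nat \<Rightarrow> 'k witt) \<Rightarrow> nat \<Rightarrow> 'k fls witt" where
  "wpartial T C M = (\<Sum>i\<in>{i\<in>prime_to CHAR('k). i < M}. wconst (C i) * wteich (inverse (T ^ i)))"

definition wsums :: "'k::{field,finite} fls \<Rightarrow> (nat \<Rightarrow> 'k witt) \<Rightarrow> 'k fls witt \<Rightarrow> bool" where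
  "wsums T C S \<longleftrightarrow> (\<forall>n. \<exists>N. \<forall>M\<ge>N. S - wpartial T C M \<in> range (\<lambda>y. of_nat (CHAR('k) ^ n) * y))"

definition wnull :: "(nat \<Rightarrow> 'k::{field,finite} witt) \<Rightarrow> bool" where
  "wnull C \<longleftrightarrow> (\<forall>n. \<exists>N. \<forall>i\<in>prime_to CHAR('k). N \<le> i \<longrightarrow> wlow n (C i))"

text \<open>The content of \<open>represents\<close> on the type of Witt vectors: c is required to
  be F-invariant instead of having components in the prime field, and the values of C off
  \<open>prime_to\<close> stay free.\<close>

definition wrep ::
    "'k::{field,finite} \<Rightarrow> 'k fls \<Rightarrow> 'k fls witt \<Rightarrow> 'k witt \<Rightarrow> (nat \<Rightarrow> 'k witt) \<Rightarrow> bool" where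
  "wrep \<alpha> T X c C \<longleftrightarrow> wfrob c = c \<and> wnull C \<and>
     (\<exists>S. wsums T C S \<and> X - (wconst c * wconst (wteich \<alpha>) + S) \<in> range wAS)"

lemma wnth_wpartial_0: "wnth (wpartial T C M) 0 = polar_sum T M (\<lambda>i. wnth (C i) 0)"
  by (simp add: wpartial_def polar_sum_def wnth_0.hom_sum)

lemma wpartial_cong:
  "(\<And>i. i \<in> prime_to CHAR('k) \<Longrightarrow> C i = D i) \<Longrightarrow>
    wpartial T C M = wpartial T (D :: nat \<Rightarrow> 'k::{field,finite} witt) M"
  by (auto simp: wpartial_def intro: sum.cong)

lemma wpartial_diff: "wpartial T (\<lambda>i. C i - D i) M = wpartial T C M - wpartial T D M"
  by (simp add: wpartial_def wconst.hom_diff left_diff_distrib sum_subtractf)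

lemma wpartial_of_nat_mult: "wpartial T (\<lambda>i. of_nat n * C i) M = of_nat n * wpartial T C M"
  by (simp add: wpartial_def wconst.hom_mult wconst.hom_of_nat sum_distrib_left mult.assoc)

lemma wpartial_extend:
  assumes "\<And>i. M \<le> i \<Longrightarrow> C i = 0" and "M \<le> N"
  shows "wpartial T C M = wpartial T C N"
proof -
  have "C i = 0" if "\<not> i < M" for i
    using assms(1) that by simp
  with assms(2) show ?thesis
    unfolding wpartial_def by (intro sum.mono_neutral_left) (auto simp: wconst.hom_zero)
qed

lemma prime_CHAR_fls: "prime CHAR('k::{field,finite} fls)"
  by (simp add: prime_CHAR_finite)

text \<open>One p-adic digit: the decomposition of component 0 in K is lifted by Teichmueller
  representatives, and \<open>exists_wAS_of_coeff_0\<close> absorbs the discrepancy.\<close>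

lemma witt_decomp_step:
  fixes \<alpha> :: "'k::{field,finite}"
  assumes "field_trace \<alpha> \<noteq> 0" and "fls_subdegree T = 1"
  shows "\<exists>c e M Y X'. c \<in> prime_subfield \<and> (\<forall>i\<ge>M. e i = 0) \<and>
     X = wconst (wteich c) * wconst (wteich \<alpha>) + wpartial T (\<lambda>i. wteich (e i)) M + wAS Y +
       of_nat CHAR('k) * X'"
proof -
  obtain c e M y where *: "c \<in> prime_subfield" "\<forall>i\<ge>M. e i = 0"
    "wnth X 0 = fls_const (c * \<alpha>) + polar_sum T M e + (y ^ CHAR('k) - y)"
    using AS_decomposable[OF assms, of "wnth X 0"] unfolding AS_decomposable_def by blast
  let ?Z = "wconst (wteich c) * wconst (wteich \<alpha>) + wpartial T (\<lambda>i. wteich (e i)) M"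
  have "wnth X 0 = wnth (?Z + wAS (wteich y)) 0"
    by (simp add: *(3) wnth_wAS_0 wnth_wpartial_0)
  from exists_wAS_of_coeff_0[OF prime_CHAR_fls this] obtain X' Y where
    "X = ?Z + wAS (wteich y) + wAS Y + of_nat CHAR('k) * X'" by auto
  then have "X = ?Z + wAS (wteich y + Y) + of_nat CHAR('k) * X'"
    by (simp add: wAS_add[OF prime_CHAR_fls] add.assoc)
  with *(1,2) show ?thesis by blast
qed

lemma wpartial_psum:
  "wpartial T (\<lambda>i. psum (\<lambda>n. E n i)) M = psum (\<lambda>n. wpartial T (E n) M)"
proof -
  have "wconst (psum (\<lambda>n. E n i)) * wteich t = psum (\<lambda>n. wconst (E n i) * wteich t)" for i t
    by (rule psum_additive[of "\<lambda>x. wconst x * wteich t", OF prime_CHAR_finite])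
       (simp_all add: wconst.hom_add distrib_right)
  then show ?thesis
    by (simp add: wpartial_def psum_sum[OF prime_CHAR_fls])
qed

text \<open>Iterating the step gives remainders \<open>u n\<close>, and the coefficients collect the
  n-th digits with weight \<open>p ^ n\<close>. Every digit involves only finitely many indices,
  which forces \<open>C i\<close> to tend to 0.\<close>

lemma wrep_exists:
  fixes \<alpha> :: "'k::{field,finite}"
  assumes "field_trace \<alpha> \<noteq> 0" and "fls_subdegree T = 1"
  obtains c C where "wrep \<alpha> T X c C"
proof -
  note pf = prime_CHAR_fls[where 'k = 'k]
  let ?p = "CHAR('k)"
  let ?\<beta> = "wconst (wteich \<alpha>)"
  obtain fc fe fM fY fX where f:
    "\<And>X. fc X \<in> prime_subfield" "\<And>X i. fM X \<le> i \<Longrightarrow> fe X i = 0"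
    "\<And>X. X = wconst (wteich (fc X)) * ?\<beta> + wpartial T (\<lambda>i. wteich (fe X i)) (fM X) + wAS (fY X) +
       of_nat ?p * fX X"
    using witt_decomp_step[OF assms] by metis
  define u where "u n = (fX ^^ n) X" for n
  define E where "E n i = wteich (fe (u n) i)" for n i
  define c where "c = psum (\<lambda>n. wteich (fc (u n)))"
  define C where "C i = psum (\<lambda>n. E n i)" for i
  \<comment> \<open>A p-adic sum of finite sums, each taken up to the bound that belongs to its own
    digit.\<close>
  define S where "S = psum (\<lambda>n. wpartial T (E n) (fM (u n)))"
  have E: "fM (u n) \<le> i \<Longrightarrow> E n i = 0" for n i
    using f(2) by (simp add: E_def)
  have bound: "\<exists>N. \<forall>j<n. fM (u j) \<le> N" for n
    by (intro exI[of _ "\<Sum>j<n. fM (u j)"]) (auto intro: member_le_sum)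
  have "wfrob c = c"
    unfolding c_def by (rule psum_fixed) (rule f(1))
  moreover have "wnull C"
    unfolding wnull_def
  proof
    fix n
    obtain N where N: "\<And>j. j < n \<Longrightarrow> fM (u j) \<le> N" using bound[of n] by blast
    have "wlow n (C i)" if "N \<le> i" for i
    proof -
      have "C i = of_nat (?p ^ n) * psum (\<lambda>k. E (n + k) i)"
        unfolding C_def using N that
        by (intro psum_drop prime_CHAR_finite E) (meson order_trans)
      then show ?thesis by (simp only: wlow_CHAR_power_mult[OF prime_CHAR_finite])
    qed
    then show "\<exists>N. \<forall>i\<in>prime_to ?p. N \<le> i \<longrightarrow> wlow n (C i)" by blast
  qed
  moreover have "wsums T C S"
    unfolding wsums_def
  proof
    fix n
    obtain N where N: "\<And>j. j < n \<Longrightarrow> fM (u j) \<le> N" using bound[of n] by blast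
    have "S - wpartial T C M \<in> range (\<lambda>y. of_nat (?p ^ n) * y)" if "N \<le> M" for M
    proof -
      \<comment> \<open>The error in digit k. It vanishes for k < n once M reaches the bounds of
        these digits, which leaves a multiple of \<open>p ^ n\<close>.\<close>
      define z where "z k = wpartial T (E k) (fM (u k)) + - wpartial T (E k) M" for k
      have "S - wpartial T C M = psum (\<lambda>k. wpartial T (E k) (fM (u k))) + - psum (\<lambda>k. wpartial T (E k) M)"
        unfolding S_def C_def wpartial_psum by simp
      also have "- psum (\<lambda>k. wpartial T (E k) M) = psum (\<lambda>k. - wpartial T (E k) M)"
        by (rule psum_additive[OF pf refl]) simp
      also have "psum (\<lambda>k. wpartial T (E k) (fM (u k))) + \<dots> = psum z"
        unfolding z_def by (rule psum_add[OF pf, symmetric])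
      also have "\<dots> = of_nat (CHAR('k fls) ^ n) * psum (\<lambda>k. z (n + k))"
      proof (rule psum_drop[OF pf])
        fix j assume "j < n"
        then have "wpartial T (E j) (fM (u j)) = wpartial T (E j) M"
          using N that by (intro wpartial_extend E) (auto intro: order_trans)
        then show "z j = 0" by (simp add: z_def)
      qed
      finally show ?thesis by auto
    qed
    then show "\<exists>N. \<forall>M\<ge>N. S - wpartial T C M \<in> range (\<lambda>y. of_nat (?p ^ n) * y)" by blast
  qed
  moreover have "X - (wconst c * ?\<beta> + S) \<in> range wAS"
  proof -
    have "u n = (wconst (wteich (fc (u n))) * ?\<beta> + wpartial T (E n) (fM (u n)) + wAS (fY (u n))) +
        of_nat CHAR('k fls) * u (Suc n)" for n
    proof -
      have "E n = (\<lambda>i. wteich (fe (u n) i))" "u (Suc n) = fX (u n)"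
        by (simp_all add: E_def u_def fun_eq_iff)
      then show ?thesis
        by (simp only: semiring_char_fls) (rule f(3))
    qed
    from psum_unique[of u, OF pf this]
    have "X = psum (\<lambda>n. wconst (wteich (fc (u n))) * ?\<beta>) + S + psum (\<lambda>n. wAS (fY (u n)))"
      by (simp add: psum_add[OF pf] S_def) (simp add: u_def)
    also have "psum (\<lambda>n. wconst (wteich (fc (u n))) * ?\<beta>) = wconst c * ?\<beta>"
      unfolding c_def
      by (rule psum_additive[symmetric, of "\<lambda>x. wconst x * ?\<beta>", OF prime_CHAR_finite])
         (simp_all add: distrib_right wconst.hom_add)
    also have "psum (\<lambda>n. wAS (fY (u n))) = wAS (psum (\<lambda>n. fY (u n)))"
      by (rule psum_additive[symmetric, OF pf refl wAS_add[OF pf]])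
    finally show ?thesis by simp
  qed
  ultimately show ?thesis using that unfolding wrep_def by blast
qed

section \<open>Uniqueness by p-adic descent\<close>

lemma of_nat_CHAR_dvd_witt:
  fixes x :: "'k::{field,finite} witt"
  assumes "wnth x 0 = 0"
  obtains x' where "x = of_nat CHAR('k) * x'"
proof -
  \<comment> \<open>As k is perfect, p-th roots of the shifted components exist, and
    \<open>x = V (F a) = p a\<close>.\<close>
  have "\<forall>n. \<exists>a. a ^ CHAR('k) = wnth x (Suc n)"
    using surj_power_CHAR[where 'k = 'k] by (metis surjE)
  then obtain a where "\<And>n. a n ^ CHAR('k) = wnth x (Suc n)" by metis
  then have "x = of_nat CHAR('k) * Witt a"
    using assms
    by (intro witt_eqI)
       (simp add: of_nat_CHAR_mult_witt[OF prime_CHAR_finite] wver_def split: nat.split)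
  then show ?thesis by (rule that)
qed

lemma wlow_CHAR_mult_iff:
  "wlow (Suc n) (of_nat CHAR('k) * x) \<longleftrightarrow> wlow n (x :: 'k::{field,finite} witt)"
  by (simp add: of_nat_CHAR_mult_witt[OF prime_CHAR_finite] wlow_wver)
     (simp add: wlow_def prime_gt_0_nat[OF prime_CHAR_finite])

text \<open>Multiples of p have vanishing component 0, so convergence modulo p already fixes
  component 0 of the sum.\<close>

lemma wsums_coeff_0:
  assumes "wsums T (C :: nat \<Rightarrow> 'k::{field,finite} witt) S"
  obtains N where "\<And>M. N \<le> M \<Longrightarrow> wnth S 0 = polar_sum T M (\<lambda>i. wnth (C i) 0)"
proof -
  obtain N where N: "\<And>M. N \<le> M \<Longrightarrow> S - wpartial T C M \<in> range (\<lambda>y. of_nat CHAR('k) * y)"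
    using assms unfolding wsums_def by (metis power_one_right)
  have "wnth S 0 = polar_sum T M (\<lambda>i. wnth (C i) 0)" if M: "N \<le> M" for M
  proof -
    obtain y where "S = wpartial T C M + of_nat CHAR('k fls) * y"
      using N[OF M] by (auto simp: diff_eq_eq add.commute)
    then show ?thesis
      by (simp add: wnth_wpartial_0 of_nat_CHAR_mult_witt[OF prime_CHAR_fls] del: semiring_char_fls)
  qed
  then show ?thesis using that by blast
qed

lemma of_nat_CHAR_cancel:
  fixes x y :: "'a::comm_ring_1 witt"
  assumes "prime CHAR('a)" "\<And>a::'a. a ^ CHAR('a) = 0 \<Longrightarrow> a = 0"
    and "of_nat CHAR('a) * x = of_nat CHAR('a) * y"
  shows "x = y"
  using CHAR_mult_witt_eq_0[OF assms(1,2), of "x - y"] assms(3) by (simp add: right_diff_distrib)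

text \<open>Components 0 give an equation in K that kills first the polar coefficients and then the
  constant. All data are then multiples of p, and absence of torsion allows one division.\<close>

lemma wrep_0_divide:
  fixes \<alpha> :: "'k::{field,finite}"
  assumes \<alpha>: "field_trace \<alpha> \<noteq> 0" and T: "fls_subdegree T = 1"
    and fixed: "wfrob d = d" and null: "wnull D" and sums: "wsums T D S"
    and AS: "wconst d * wconst (wteich \<alpha>) + S \<in> range wAS"
  obtains d' D' S' where "d = of_nat CHAR('k) * d'"
    "\<And>i. i \<in> prime_to CHAR('k) \<Longrightarrow> D i = of_nat CHAR('k) * D' i"
    "wfrob d' = d'" "wnull D'" "wsums T D' S'" "wconst d' * wconst (wteich \<alpha>) + S' \<in> range wAS"
proof -
  let ?p = "CHAR('k)"
  note pk = prime_CHAR_finite[where 'k = 'k] and pf = prime_CHAR_fls[where 'k = 'k]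
  have red: "a ^ CHAR('k fls) = 0 \<Longrightarrow> a = 0" for a :: "'k fls" by simp
  obtain N where N: "\<And>M. N \<le> M \<Longrightarrow> wnth S 0 = polar_sum T M (\<lambda>i. wnth (D i) 0)"
    using wsums_coeff_0[OF sums] by blast
  obtain Y where Y: "wconst d * wconst (wteich \<alpha>) + S = wAS Y" using AS by auto
  define y where "y = wnth Y 0"
  have eq: "fls_const (wnth d 0 * \<alpha>) + polar_sum T M (\<lambda>i. wnth (D i) 0) = y ^ ?p - y"
    if "N \<le> M" for M
    using arg_cong[OF Y, of "\<lambda>x. wnth x 0"] N[OF that]
    by (simp add: wnth_wAS_0 y_def)
  \<comment> \<open>The bound \<open>Suc i\<close> makes index i occur in the truncated sum.\<close>
  have D0: "wnth (D i) 0 = 0" if "i \<in> prime_to ?p" for i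
    using polar_sum_eq_AS_imp_0[OF T eq[of "max N (Suc i)"] that] by simp
  then have "polar_sum T N (\<lambda>i. wnth (D i) 0) = 0"
    by (simp add: polar_sum_def)
  with eq[of N] have "fls_const (wnth d 0 * \<alpha>) = y ^ ?p - y" by simp
  then obtain y0 where "wnth d 0 * \<alpha> = y0 ^ ?p - y0" by (rule fls_const_eq_AS_imp)
  then have "wnth d 0 = 0"
    using prime_subfield_mult_eq_0[OF \<alpha>] fixed fixed_iff_prime_subfield[of d] by blast
  then obtain d' where d': "d = of_nat ?p * d'" by (rule of_nat_CHAR_dvd_witt)
  have "\<forall>i\<in>prime_to ?p. \<exists>x. D i = of_nat ?p * x"
    using D0 of_nat_CHAR_dvd_witt by metis
  then obtain D' where D': "\<And>i. i \<in> prime_to ?p \<Longrightarrow> D i = of_nat ?p * D' i"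
    by metis
  interpret wfrob: comm_ring_hom "wfrob :: 'k witt \<Rightarrow> _" by (rule comm_ring_hom_wfrob[OF pk])
  have "of_nat ?p * wfrob d' = of_nat ?p * d'"
    using fixed unfolding d' by (simp only: wfrob.hom_mult wfrob.hom_of_nat)
  then have "wfrob d' = d'"
    by (rule of_nat_CHAR_cancel[OF pk, rotated]) simp
  moreover have "wnull D'"
    unfolding wnull_def
  proof
    fix n
    obtain N where "\<forall>i\<in>prime_to ?p. N \<le> i \<longrightarrow> wlow (Suc n) (D i)"
      using null unfolding wnull_def by blast
    then show "\<exists>N. \<forall>i\<in>prime_to ?p. N \<le> i \<longrightarrow> wlow n (D' i)"
      by (auto simp: D' wlow_CHAR_mult_iff)
  qed
  moreover have part: "wpartial T D M = of_nat ?p * wpartial T D' M" for M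
    using wpartial_cong[of D "\<lambda>i. of_nat ?p * D' i" T M] D' by (simp add: wpartial_of_nat_mult)
  \<comment> \<open>The sum is a multiple of p because the partial sums are, and convergence at
    level 1 leaves only a multiple of p.\<close>
  obtain S' where S': "S = of_nat ?p * S'"
  proof -
    obtain N where "S - wpartial T D N \<in> range (\<lambda>y. of_nat (?p ^ 1) * y)"
      using sums unfolding wsums_def by blast
    then obtain y where "S = of_nat ?p * wpartial T D' N + of_nat ?p * y"
      unfolding part by (auto simp: diff_eq_eq add.commute)
    then have "S = of_nat ?p * (wpartial T D' N + y)" by (simp add: distrib_left)
    then show ?thesis by (rule that)
  qed
  have "wsums T D' S'"
    unfolding wsums_def
  proof
    fix n
    \<comment> \<open>Cancelling p costs one level of convergence, hence
      \<open>Suc n\<close>.\<close>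
    obtain N where N: "\<And>M. N \<le> M \<Longrightarrow> S - wpartial T D M \<in> range (\<lambda>y. of_nat (?p ^ Suc n) * y)"
      using sums unfolding wsums_def by blast
    have "S' - wpartial T D' M \<in> range (\<lambda>y. of_nat (?p ^ n) * y)" if M: "N \<le> M" for M
    proof -
      obtain y where y: "S - wpartial T D M = of_nat (?p ^ Suc n) * y"
        using N[OF M] by blast
      have "of_nat ?p * (S' - wpartial T D' M) = S - wpartial T D M"
        by (simp only: S' part right_diff_distrib)
      also have "\<dots> = of_nat ?p * (of_nat (?p ^ n) * y)"
        by (simp only: y power_Suc of_nat_mult mult.assoc)
      finally have "S' - wpartial T D' M = of_nat (?p ^ n) * y"
        by (rule of_nat_CHAR_cancel[OF pf red, unfolded semiring_char_fls, rotated])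
      then show ?thesis by blast
    qed
    then show "\<exists>N. \<forall>M\<ge>N. S' - wpartial T D' M \<in> range (\<lambda>y. of_nat (?p ^ n) * y)" by blast
  qed
  moreover have "wconst d' * wconst (wteich \<alpha>) + S' \<in> range wAS"
  proof (rule range_wAS_divide_CHAR[OF pf red])
    have "wconst d * wconst (wteich \<alpha>) + S =
        of_nat CHAR('k fls) * (wconst d' * wconst (wteich \<alpha>) + S')"
      by (simp add: d' S' wconst.hom_mult wconst.hom_of_nat distrib_left mult.assoc)
    with AS show "of_nat CHAR('k fls) * (wconst d' * wconst (wteich \<alpha>) + S') \<in> range wAS" by simp
  qed
  ultimately show ?thesis using that[of d' D' S'] d' D' by blast
qed

text \<open>Each division by p accounts for one more vanishing leading component, so in the end all
  components vanish.\<close>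

lemma wrep_0_unique:
  fixes \<alpha> :: "'k::{field,finite}"
  assumes "field_trace \<alpha> \<noteq> 0" and "fls_subdegree T = 1"
    and "wfrob d = d" "wnull D" "wsums T D S" "wconst d * wconst (wteich \<alpha>) + S \<in> range wAS"
  shows "d = 0" and "i \<in> prime_to CHAR('k) \<Longrightarrow> D i = 0"
proof -
  have "wlow n d \<and> (\<forall>i\<in>prime_to CHAR('k). wlow n (D i))" for n
    using assms(3-)
  proof (induction n arbitrary: d D S)
    case 0
    then show ?case by (simp add: wlow_def)
  next
    case (Suc n)
    obtain d' D' S' where *: "d = of_nat CHAR('k) * d'"
      "\<And>i. i \<in> prime_to CHAR('k) \<Longrightarrow> D i = of_nat CHAR('k) * D' i"
      and rep: "wfrob d' = d'" "wnull D'" "wsums T D' S'"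
      "wconst d' * wconst (wteich \<alpha>) + S' \<in> range wAS"
      using wrep_0_divide[OF assms(1,2) Suc.prems] by metis
    from Suc.IH[OF rep] show ?case
      by (simp add: * wlow_CHAR_mult_iff)
  qed
  then show "d = 0" and "i \<in> prime_to CHAR('k) \<Longrightarrow> D i = 0"
    by (auto intro: wlow_all_imp_0)
qed

lemma wnull_diff: "wnull C \<Longrightarrow> wnull D \<Longrightarrow> wnull (\<lambda>i. C i - D i)"
  unfolding wnull_def by (meson wlow_diff le_trans nat_le_linear)

lemma wsums_diff:
  assumes "wsums T C S" "wsums T (D :: nat \<Rightarrow> 'k::{field,finite} witt) S'"
  shows "wsums T (\<lambda>i. C i - D i) (S - S')"
  unfolding wsums_def
proof
  fix n
  obtain N N' where N: "\<And>M. N \<le> M \<Longrightarrow> S - wpartial T C M \<in> range (\<lambda>y. of_nat (CHAR('k) ^ n) * y)"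
    "\<And>M. N' \<le> M \<Longrightarrow> S' - wpartial T D M \<in> range (\<lambda>y. of_nat (CHAR('k) ^ n) * y)"
    using assms unfolding wsums_def by blast
  have "S - S' - wpartial T (\<lambda>i. C i - D i) M \<in> range (\<lambda>y. of_nat (CHAR('k) ^ n) * y)"
    if M: "max N N' \<le> M" for M
  proof -
    obtain y y' where y: "S - wpartial T C M = of_nat (CHAR('k) ^ n) * y"
      "S' - wpartial T D M = of_nat (CHAR('k) ^ n) * y'"
      using N(1)[of M] N(2)[of M] M[unfolded max.bounded_iff] by blast
    have "S - S' - wpartial T (\<lambda>i. C i - D i) M = (S - wpartial T C M) - (S' - wpartial T D M)"
      by (simp add: wpartial_diff)
    also have "\<dots> = of_nat (CHAR('k) ^ n) * (y - y')"
      unfolding y by (simp add: right_diff_distrib)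
    finally show ?thesis by blast
  qed
  then show "\<exists>N. \<forall>M\<ge>N. S - S' - wpartial T (\<lambda>i. C i - D i) M \<in> range (\<lambda>y. of_nat (CHAR('k) ^ n) * y)"
    by blast
qed

lemma wrep_unique:
  fixes \<alpha> :: "'k::{field,finite}"
  assumes "field_trace \<alpha> \<noteq> 0" and "fls_subdegree T = 1"
    and rep: "wrep \<alpha> T X c C" "wrep \<alpha> T X d D"
  shows "c = d" and "i \<in> prime_to CHAR('k) \<Longrightarrow> C i = D i"
proof -
  note pf = prime_CHAR_fls[where 'k = 'k]
  let ?\<beta> = "wconst (wteich \<alpha>)"
  interpret wfrob: comm_ring_hom "wfrob :: 'k witt \<Rightarrow> _"
    by (rule comm_ring_hom_wfrob[OF prime_CHAR_finite])
  obtain S S' where S: "wsums T C S" "X - (wconst c * ?\<beta> + S) \<in> range wAS"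
    "wsums T D S'" "X - (wconst d * ?\<beta> + S') \<in> range wAS"
    using rep unfolding wrep_def by blast
  have "wconst (c - d) * ?\<beta> + (S - S') = (X - (wconst d * ?\<beta> + S')) - (X - (wconst c * ?\<beta> + S))"
    by (simp add: wconst.hom_diff left_diff_distrib)
  also have "\<dots> \<in> range wAS"
    by (rule range_wAS_diff[OF pf S(4,2)])
  finally have AS: "wconst (c - d) * ?\<beta> + (S - S') \<in> range wAS" .
  have "wfrob (c - d) = c - d" "wnull (\<lambda>i. C i - D i)"
    using rep by (simp_all add: wrep_def wfrob.hom_diff wnull_diff)
  note 0 = wrep_0_unique[OF assms(1,2) this wsums_diff[OF S(1,3)] AS]
  show "c = d" using 0(1) by simp
  show "C i = D i" if "i \<in> prime_to CHAR('k)" using 0(2)[OF that] by simp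
qed

text \<open>Serves (ii): uniqueness compares this representative with an arbitrary one and
  identifies the constant.\<close>

lemma wrep_const:
  fixes \<alpha> :: "'k::{field,finite}"
  assumes "wfrob c = c" and "X - wconst c * wconst (wteich \<alpha>) \<in> range wAS"
  shows "wrep \<alpha> T X c (\<lambda>_. 0)"
proof -
  have "wsums T (\<lambda>_. 0 :: 'k witt) 0"
    unfolding wsums_def wpartial_def
    by (simp add: wconst.hom_zero) (metis mult_zero_right rangeI)
  moreover have "wnull (\<lambda>_. 0 :: 'k witt)" by (simp add: wnull_def)
  ultimately show ?thesis
    unfolding wrep_def using assms by (auto intro!: exI[of _ 0])
qed

section \<open>The valuation of the coefficients\<close>

lemma wlow_of_nat_mult: "wlow n x \<Longrightarrow> wlow n (of_nat k * x :: 'a::comm_ring_1 witt)"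
  by (induction k) (simp_all add: distrib_right wlow_add)

text \<open>Serves (iii) with k a power of p: a representative of Z is scaled by k and shifted by a
  multiple of \<beta>.\<close>

lemma wrep_add_CHAR_power_mult:
  fixes \<alpha> :: "'k::{field,finite}"
  assumes c: "wfrob c = c" and rep: "wrep \<alpha> T Z d D"
    and X: "X - (wconst c * wconst (wteich \<alpha>) + of_nat k * Z) \<in> range wAS"
  shows "wrep \<alpha> T X (c + of_nat k * d) (\<lambda>i. of_nat k * D i)"
proof -
  note pf = prime_CHAR_fls[where 'k = 'k]
  let ?\<beta> = "wconst (wteich \<alpha>)"
  interpret wfrob: comm_ring_hom "wfrob :: 'k witt \<Rightarrow> _"
    by (rule comm_ring_hom_wfrob[OF prime_CHAR_finite])
  obtain S where S: "wsums T D S" "Z - (wconst d * ?\<beta> + S) \<in> range wAS"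
    using rep unfolding wrep_def by blast
  have "wfrob (c + of_nat k * d) = c + of_nat k * d"
    using c rep by (simp add: wrep_def wfrob.hom_add wfrob.hom_mult wfrob.hom_of_nat)
  moreover have "wnull (\<lambda>i. of_nat k * D i)"
    using rep unfolding wrep_def wnull_def by (meson wlow_of_nat_mult)
  moreover have "wsums T (\<lambda>i. of_nat k * D i) (of_nat k * S)"
    unfolding wsums_def
  proof
    fix n
    obtain N where N: "\<And>M. N \<le> M \<Longrightarrow> S - wpartial T D M \<in> range (\<lambda>y. of_nat (CHAR('k) ^ n) * y)"
      using S(1) unfolding wsums_def by blast
    have "of_nat k * S - wpartial T (\<lambda>i. of_nat k * D i) M \<in> range (\<lambda>y. of_nat (CHAR('k) ^ n) * y)"
      if M: "N \<le> M" for M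
    proof -
      obtain y where "S - wpartial T D M = of_nat (CHAR('k) ^ n) * y" using N[OF M] by auto
      then have "of_nat k * S - wpartial T (\<lambda>i. of_nat k * D i) M =
          of_nat (CHAR('k) ^ n) * (of_nat k * y)"
        by (simp add: wpartial_of_nat_mult mult.left_commute flip: right_diff_distrib)
      then show ?thesis by blast
    qed
    then show "\<exists>N. \<forall>M\<ge>N. of_nat k * S - wpartial T (\<lambda>i. of_nat k * D i) M
        \<in> range (\<lambda>y. of_nat (CHAR('k) ^ n) * y)" by blast
  qed
  moreover have "X - (wconst (c + of_nat k * d) * ?\<beta> + of_nat k * S) \<in> range wAS"
  proof -
    obtain Y where "Z - (wconst d * ?\<beta> + S) = wAS Y" using S(2) by auto
    then have "of_nat k * (Z - (wconst d * ?\<beta> + S)) = wAS (of_nat k * Y)"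
      by (simp add: additive_of_nat_mult wAS_add[OF pf])
    then have "X - (wconst (c + of_nat k * d) * ?\<beta> + of_nat k * S) =
        (X - (wconst c * ?\<beta> + of_nat k * Z)) + wAS (of_nat k * Y)"
      by (simp add: wconst.hom_add wconst.hom_mult wconst.hom_of_nat algebra_simps)
    also have "\<dots> \<in> range wAS"
      by (rule range_wAS_add[OF pf X]) simp
    finally show ?thesis .
  qed
  ultimately show ?thesis unfolding wrep_def by blast
qed

text \<open>The terms \<open>V ^ i [x_i]\<close> are peeled off one by one; each is integral, hence
  congruent to a multiple of \<beta>, and the multiples add up.\<close>

lemma integral_head_decomp:
  fixes X :: "'k::{field,finite} fls witt"
  assumes \<alpha>: "field_trace \<alpha> \<noteq> 0" and "\<And>i. i < j \<Longrightarrow> fls_subdegree (wnth X i) \<ge> 0"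
  shows "\<exists>c. wfrob c = c \<and>
    X - (wconst c * wconst (wteich \<alpha>) + (wver ^^ j) (Witt (\<lambda>i. wnth X (j + i)))) \<in> range wAS"
  using assms(2)
proof (induction j)
  case 0
  have "Witt (wnth X) = X" by simp
  moreover have "wfrob (0 :: 'k witt) = 0"
    by (rule comm_ring_hom.hom_zero[OF comm_ring_hom_wfrob[OF prime_CHAR_finite]])
  moreover have "(0 :: 'k fls witt) \<in> range wAS"
    using wAS_diff[OF prime_CHAR_fls, of "0 :: 'k fls witt" 0] by (metis diff_self rangeI)
  ultimately show ?case
    by (intro exI[of _ 0]) (simp add: wconst.hom_zero)
next
  case (Suc j)
  note pf = prime_CHAR_fls[where 'k = 'k]
  let ?\<beta> = "wconst (wteich \<alpha>)"
  let ?Z = "\<lambda>j. Witt (\<lambda>i. wnth X (j + i))"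
  interpret wfrob: comm_ring_hom "wfrob :: 'k witt \<Rightarrow> _"
    by (rule comm_ring_hom_wfrob[OF prime_CHAR_finite])
  obtain c where c: "wfrob c = c" "X - (wconst c * ?\<beta> + (wver ^^ j) (?Z j)) \<in> range wAS"
    using Suc by auto
  have "?Z j = wteich (wnth X j) + wver (?Z (Suc j))"
    using wteich_wver_decomp[of "?Z j"] by (simp add: wtl_def)
  then have Z: "(wver ^^ j) (?Z j) = (wver ^^ j) (wteich (wnth X j)) + (wver ^^ Suc j) (?Z (Suc j))"
    by (simp add: wver_funpow_add funpow_swap1)
  have "fls_subdegree (wnth ((wver ^^ j) (wteich (wnth X j))) n) \<ge> 0" for n
    using Suc.prems[of j] by (simp add: wnth_wver_funpow teich_def)
  then obtain d where d: "wfrob d = d"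
    "(wver ^^ j) (wteich (wnth X j)) - wconst d * ?\<beta> \<in> range wAS"
    by (rule integral_witt_decomp[OF \<alpha>])
  have "X - (wconst (c + d) * ?\<beta> + (wver ^^ Suc j) (?Z (Suc j))) =
      (X - (wconst c * ?\<beta> + (wver ^^ j) (?Z j))) +
      ((wver ^^ j) (wteich (wnth X j)) - wconst d * ?\<beta>)"
    unfolding Z by (simp add: wconst.hom_add distrib_right)
  also have "\<dots> \<in> range wAS"
    by (rule range_wAS_add[OF pf c(2) d(2)])
  finally show ?case
    using c(1) d(1) by (intro exI[of _ "c + d"]) (simp add: wfrob.hom_add)
qed

text \<open>From \<open>p ^ j = V ^ j F ^ j\<close>. Over a field, component j of the product thus
  detects whether component 0 of x vanishes.\<close>

lemma wnth_CHAR_power_mult: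
  "wnth (of_nat (CHAR('k) ^ j) * x) j = wnth (x :: 'k::{field,finite} witt) 0 ^ (CHAR('k) ^ j)"
proof (induction j)
  case (Suc j)
  have "of_nat (CHAR('k) ^ Suc j) * x = wver (wfrob (of_nat (CHAR('k) ^ j) * x))"
    using of_nat_CHAR_mult_witt[OF prime_CHAR_finite[where 'k = 'k], of "of_nat (CHAR('k) ^ j) * x"]
    by (simp add: mult.assoc)
  then have "wnth (of_nat (CHAR('k) ^ Suc j) * x) (Suc j) = wnth (of_nat (CHAR('k) ^ j) * x) j ^ CHAR('k)"
    by simp
  then show ?case
    unfolding Suc.IH by (simp add: mult.commute flip: power_mult)
qed simp

text \<open>X is congruent to a multiple of \<beta> plus \<open>V ^ j Z\<close>, hence plus
  \<open>p ^ j Z\<close>, and uniqueness forces \<open>C i = p ^ j D i\<close> for the coefficients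
  D of Z. The pole of \<open>wnth Z 0 = wnth X j\<close> keeps the components 0 of the
  \<open>D i\<close> from all vanishing.\<close>

lemma wrep_min_valuation:
  fixes \<alpha> :: "'k::{field,finite}"
  assumes \<alpha>: "field_trace \<alpha> \<noteq> 0" and T: "fls_subdegree T = 1"
    and rep: "wrep \<alpha> T X c C"
    and int: "\<And>i. i < j \<Longrightarrow> fls_subdegree (wnth X i) \<ge> 0"
    and neg: "fls_subdegree (wnth X j) < 0" and ndvd: "\<not> int CHAR('k) dvd fls_subdegree (wnth X j)"
  shows "\<forall>i\<in>prime_to CHAR('k). wlow j (C i)" and "\<exists>i\<in>prime_to CHAR('k). wnth (C i) j \<noteq> 0"
proof -
  let ?p = "CHAR('k)"
  note pf = prime_CHAR_fls[where 'k = 'k]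
  let ?\<beta> = "wconst (wteich \<alpha>)"
  define Z where "Z = Witt (\<lambda>i. wnth X (j + i))"
  obtain c' where c': "wfrob c' = c'" "X - (wconst c' * ?\<beta> + (wver ^^ j) Z) \<in> range wAS"
    using integral_head_decomp[OF \<alpha>, where j = j and X = X] int unfolding Z_def by auto
  obtain d D where D: "wrep \<alpha> T Z d D" using wrep_exists[OF \<alpha> T] .
  have "X - (wconst c' * ?\<beta> + of_nat (?p ^ j) * Z) =
      (X - (wconst c' * ?\<beta> + (wver ^^ j) Z)) - (of_nat (CHAR('k fls) ^ j) * Z - (wver ^^ j) Z)"
    by simp
  also have "\<dots> \<in> range wAS"
    by (rule range_wAS_diff[OF pf c'(2) range_wAS_wver_funpow[OF pf]])
  finally have "wrep \<alpha> T X (c' + of_nat (?p ^ j) * d) (\<lambda>i. of_nat (?p ^ j) * D i)"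
    by (rule wrep_add_CHAR_power_mult[OF c'(1) D])
  from wrep_unique(2)[OF \<alpha> T rep this]
  have C: "C i = of_nat (?p ^ j) * D i" if "i \<in> prime_to ?p" for i
    using that by blast
  show "\<forall>i\<in>prime_to ?p. wlow j (C i)"
    using C wlow_CHAR_power_mult[OF prime_CHAR_finite] by metis
  show "\<exists>i\<in>prime_to ?p. wnth (C i) j \<noteq> 0"
  proof (rule ccontr)
    assume contr: "\<not> (\<exists>i\<in>prime_to ?p. wnth (C i) j \<noteq> 0)"
    have D0: "wnth (D i) 0 = 0" if "i \<in> prime_to ?p" for i
    proof -
      have "wnth (of_nat (?p ^ j) * D i) j = 0" using contr C that by auto
      then show ?thesis unfolding wnth_CHAR_power_mult by simp
    qed
    obtain S Y where S: "wsums T D S" and Y: "Z - (wconst d * ?\<beta> + S) = wAS Y"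
      using D unfolding wrep_def by auto
    obtain N where "wnth S 0 = polar_sum T N (\<lambda>i. wnth (D i) 0)"
      using wsums_coeff_0[OF S] by blast
    then have "wnth S 0 = 0" using D0 by (simp add: polar_sum_def)
    have "Z = wconst d * ?\<beta> + S + wAS Y" using Y by (simp add: algebra_simps)
    then have "wnth Z 0 = wnth (wconst d * ?\<beta> + S + wAS Y) 0" by simp
    \<comment> \<open>Without polar terms only a constant plus \<open>y ^ p - y\<close> remains, and
      any pole of that has order divisible by p.\<close>
    then have "wnth X j = fls_const (wnth d 0 * \<alpha>) + (wnth Y 0 ^ ?p - wnth Y 0)"
      using \<open>wnth S 0 = 0\<close> by (simp add: Z_def wnth_wAS_0)
    then show False
      using fls_const_add_AS_subdegree neg ndvd by metis
  qed
qed


section \<open>The ring \<open>witt_ring p\<close>\<close>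

lemma witt_ring_add:
  fixes f g :: "nat \<Rightarrow> 'a::comm_ring_1"
  assumes "prime CHAR('a)"
  shows "f \<oplus>\<^bsub>witt_ring CHAR('a)\<^esub> g = wnth (Witt f + Witt g)"
  by (simp add: witt_ring_def plus_witt_def witt_prime_eq[OF assms] wadd_def poly_eval_eq_peval)

lemma witt_ring_mult:
  fixes f g :: "nat \<Rightarrow> 'a::comm_ring_1"
  assumes "prime CHAR('a)"
  shows "f \<otimes>\<^bsub>witt_ring CHAR('a)\<^esub> g = wnth (Witt f * Witt g)"
  by (simp add: witt_ring_def times_witt_def witt_prime_eq[OF assms] wmult_def poly_eval_eq_peval)

lemma witt_ring_zero: "\<zero>\<^bsub>witt_ring p\<^esub> = wnth 0"
  by (simp add: witt_ring_def)

lemma witt_ring_carrier: "carrier (witt_ring p) = UNIV"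
  by (simp add: witt_ring_def)

lemma witt_ring_abelian_group:
  assumes p: "prime CHAR('a::comm_ring_1)"
  shows "abelian_group (witt_ring CHAR('a) :: (nat \<Rightarrow> 'a) ring)"
proof (rule abelian_groupI)
  fix f :: "nat \<Rightarrow> 'a"
  show "\<exists>g\<in>carrier (witt_ring CHAR('a)). g \<oplus>\<^bsub>witt_ring CHAR('a)\<^esub> f = \<zero>\<^bsub>witt_ring CHAR('a)\<^esub>"
    by (intro bexI[of _ "wnth (- Witt f)"])
       (simp_all add: witt_ring_add[OF p] witt_ring_zero witt_ring_carrier del: wnth_0)
qed (simp_all add: witt_ring_add[OF p] witt_ring_zero witt_ring_carrier add_ac del: wnth_0)

lemma witt_ring_minus:
  fixes f g :: "nat \<Rightarrow> 'a::comm_ring_1"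
  assumes p: "prime CHAR('a)"
  shows "f \<ominus>\<^bsub>witt_ring CHAR('a)\<^esub> g = wnth (Witt f - Witt g)"
proof -
  interpret abelian_group "witt_ring CHAR('a) :: (nat \<Rightarrow> 'a) ring"
    by (rule witt_ring_abelian_group[OF p])
  have "\<ominus>\<^bsub>witt_ring CHAR('a)\<^esub> g = wnth (- Witt g)"
    by (rule minus_equality)
       (simp_all add: witt_ring_add[OF p] witt_ring_zero witt_ring_carrier del: wnth_0)
  then show ?thesis
    by (simp add: a_minus_def witt_ring_add[OF p])
qed

lemma witt_ring_finsum:
  fixes f :: "'i \<Rightarrow> nat \<Rightarrow> 'a::comm_ring_1"
  assumes p: "prime CHAR('a)" and "finite A"
  shows "(\<Oplus>\<^bsub>witt_ring CHAR('a)\<^esub>i\<in>A. f i) = wnth (\<Sum>i\<in>A. Witt (f i))"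
proof -
  interpret abelian_group "witt_ring CHAR('a) :: (nat \<Rightarrow> 'a) ring"
    by (rule witt_ring_abelian_group[OF p])
  show ?thesis
    using assms(2)
    by (induction A)
       (simp_all add: finsum_insert witt_ring_carrier witt_ring_zero witt_ring_add[OF p] del: wnth_0)
qed

lemma witt_ring_add_pow:
  fixes f :: "nat \<Rightarrow> 'a::comm_ring_1"
  assumes p: "prime CHAR('a)"
  shows "add_pow (witt_ring CHAR('a)) (n::nat) f = wnth (of_nat n * Witt f)"
proof -
  interpret abelian_group "witt_ring CHAR('a) :: (nat \<Rightarrow> 'a) ring"
    by (rule witt_ring_abelian_group[OF p])
  show ?thesis
    by (induction n)
       (simp_all add: witt_ring_zero witt_ring_add[OF p] add.nat_pow_Suc distrib_right add.commute
         del: wnth_0)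
qed

lemma witt_inj: "wnth x = wnth y \<longleftrightarrow> x = y"
  by (auto intro: witt_eqI)

lemma wp_eq_wAS:
  fixes f :: "nat \<Rightarrow> 'a::comm_ring_1"
  assumes p: "prime CHAR('a)"
  shows "wp CHAR('a) f = wnth (wAS (Witt f))"
proof -
  have "Witt (witt_frob CHAR('a) f) = wfrob (Witt f)"
    by (rule witt_eqI) (simp add: witt_frob_def)
  then show ?thesis
    by (simp add: wp_def witt_ring_minus[OF p] wAS_def)
qed

lemma range_wp_iff:
  fixes f :: "nat \<Rightarrow> 'a::comm_ring_1"
  assumes p: "prime CHAR('a)"
  shows "f \<in> range (wp CHAR('a)) \<longleftrightarrow> Witt f \<in> range wAS"
proof -
  have "f \<in> range (wp CHAR('a)) \<longleftrightarrow> (\<exists>g. Witt f = wAS (Witt g))"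
    by (auto simp: wp_eq_wAS[OF p] witt_inj[symmetric])
  also have "\<dots> \<longleftrightarrow> Witt f \<in> range wAS"
    by (auto) (metis witt.collapse)
  finally show ?thesis .
qed

lemma witt_cong_iff:
  fixes f g :: "nat \<Rightarrow> 'a::comm_ring_1"
  assumes p: "prime CHAR('a)"
  shows "witt_cong CHAR('a) f g \<longleftrightarrow> Witt f - Witt g \<in> range wAS"
  by (simp add: witt_cong_def range_wp_iff[OF p] witt_ring_minus[OF p])

lemma witt_const_eq: "witt_const c = wnth (wconst (Witt c))"
  by (simp add: fun_eq_iff witt_const_def)

text \<open>Valuations are handled through lower bounds; the exact value j later follows from the
  bounds at j and \<open>Suc j\<close>.\<close>

lemma enat_le_witt_val: "enat n \<le> witt_val f \<longleftrightarrow> (\<forall>i<n. f i = 0)"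
proof (cases "\<forall>i. f i = 0")
  case False
  define m where "m = (LEAST i. f i \<noteq> 0)"
  from False obtain i where "f i \<noteq> 0" by blast
  then have "f m \<noteq> 0" unfolding m_def by (rule LeastI)
  moreover have "f i = 0" if "i < m" for i
    using not_less_Least[of i "\<lambda>i. f i \<noteq> 0"] that by (simp add: m_def)
  ultimately have "n \<le> m \<longleftrightarrow> (\<forall>i<n. f i = 0)"
    by (meson less_le_trans not_le)
  moreover have "witt_val f = enat m" using False by (simp add: witt_val_def m_def)
  ultimately show ?thesis by simp
qed (simp add: witt_val_def)

lemma witt_null_family_iff:
  "witt_null_family CHAR('k) cs \<longleftrightarrow> wnull (\<lambda>i. Witt (cs i :: nat \<Rightarrow> 'k::{field,finite}))"
  by (simp add: witt_null_family_def wnull_def enat_le_witt_val wlow_def)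

lemma witt_sums_iff:
  fixes cs :: "nat \<Rightarrow> nat \<Rightarrow> 'k::{field,finite}"
  shows "witt_sums CHAR('k) (\<lambda>i. witt_const (cs i) \<otimes>\<^bsub>witt_ring CHAR('k)\<^esub> teich (inverse (T ^ i))) s
    \<longleftrightarrow> wsums T (\<lambda>i. Witt (cs i)) (Witt s)"
proof -
  note p = prime_CHAR_fls[where 'k = 'k]
  let ?R = "witt_ring CHAR('k) :: (nat \<Rightarrow> 'k fls) ring"
  have fin: "finite {i\<in>prime_to CHAR('k). i < M}" for M
    by (rule finite_subset[of _ "{..<M}"]) auto
  have "s \<ominus>\<^bsub>?R\<^esub> (\<Oplus>\<^bsub>?R\<^esub>i\<in>{i\<in>prime_to CHAR('k). i < M}.
      witt_const (cs i) \<otimes>\<^bsub>?R\<^esub> teich (inverse (T ^ i))) =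
      wnth (Witt s - wpartial T (\<lambda>i. Witt (cs i)) M)" for M
    \<comment> \<open>The characteristic of the Laurent series field is rewritten to that of k, so
      that the rules match \<open>?R\<close>.\<close>
    unfolding witt_ring_finsum[OF p fin, unfolded semiring_char_fls]
      witt_ring_minus[OF p, unfolded semiring_char_fls]
      witt_ring_mult[OF p, unfolded semiring_char_fls] witt_const_eq
    by (simp add: wpartial_def wteich_def)
  moreover have "wnth x \<in> range (\<lambda>y. add_pow ?R n y) \<longleftrightarrow> x \<in> range (\<lambda>y. of_nat n * y)"
    for x :: "'k fls witt" and n :: nat
    unfolding witt_ring_add_pow[OF p, unfolded semiring_char_fls]
    by (auto simp: witt_inj) (metis witt.collapse rangeI)
  ultimately show ?thesis
    by (simp add: witt_sums_def wsums_def del: of_nat_power)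
qed

lemma represents_iff:
  fixes \<alpha> :: "'k::{field,finite}"
  shows "represents CHAR('k) \<alpha> T x c cs \<longleftrightarrow>
    cs \<in> extensional (prime_to CHAR('k)) \<and> wrep \<alpha> T (Witt x) (Witt c) (\<lambda>i. Witt (cs i))"
proof -
  note p = prime_CHAR_fls[where 'k = 'k]
  have fixed: "(\<forall>n. c n \<in> prime_subfield) \<longleftrightarrow> wfrob (Witt c) = Witt c"
    using fixed_iff_prime_subfield[of "Witt c"] by simp
  have cong: "witt_cong CHAR('k) x ((witt_const c \<otimes>\<^bsub>witt_ring CHAR('k)\<^esub> witt_const (teich \<alpha>))
      \<oplus>\<^bsub>witt_ring CHAR('k)\<^esub> s) \<longleftrightarrow>
      Witt x - (wconst (Witt c) * wconst (wteich \<alpha>) + Witt s) \<in> range wAS" for s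
    using witt_cong_iff[OF p] witt_ring_mult[OF p] witt_ring_add[OF p]
    by (simp add: witt_const_eq wteich_def)
  have "(\<exists>s. P (Witt s)) \<longleftrightarrow> (\<exists>S. P S)" for P :: "'k fls witt \<Rightarrow> bool"
    by (metis witt.collapse)
  from this[of "\<lambda>S. wsums T (\<lambda>i. Witt (cs i)) S \<and>
      Witt x - (wconst (Witt c) * wconst (wteich \<alpha>) + S) \<in> range wAS"]
  show ?thesis
    unfolding represents_def wrep_def witt_null_family_iff witt_sums_iff fixed cong by blast
qed

theorem proposition4p3:
  fixes p :: nat
    and \<alpha> :: "'k::{field,finite}"
    and T' :: "'k fls"
    and x :: "nat \<Rightarrow> 'k fls"
  assumes "CHAR('k) = p"
    and "field_trace \<alpha> \<noteq> 0"
    and "fls_val T' = 1"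
  shows "(\<exists>!(c, cs). represents p \<alpha> T' x c cs) \<and>
    (\<forall>c cs. represents p \<alpha> T' x c cs \<longrightarrow>
       ((\<forall>j. fls_val (x j) > 0) \<longrightarrow> x \<in> range (wp p)) \<and>
       ((\<forall>j. fls_val (x j) \<ge> 0) \<longrightarrow>
          witt_cong p x (witt_const c \<otimes>\<^bsub>witt_ring p\<^esub> witt_const (teich \<alpha>))) \<and>
       (\<forall>j. fls_val (x j) < 0 \<and> (\<forall>l<j. \<not> fls_val (x l) < 0) \<and>
            \<not> int p dvd fls_subdegree (x j) \<longrightarrow>
          (\<exists>i\<in>prime_to p. witt_val (cs i) = enat j) \<and>
          (\<forall>i\<in>prime_to p. enat j \<le> witt_val (cs i))))"
proof -
  note pf = prime_CHAR_fls[where 'k = 'k]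
  note \<alpha> = assms(2)
  have T: "fls_subdegree T' = 1"
    using assms(3) by (auto simp: fls_val_def one_ereal_def split: if_splits)
  have nonneg: "fls_val f \<ge> 0 \<longleftrightarrow> fls_subdegree f \<ge> 0" for f :: "'k fls"
    by (simp add: fls_val_def)
  have unique: "c = d \<and> cs = ds"
    if "represents CHAR('k) \<alpha> T' x c cs" "represents CHAR('k) \<alpha> T' x d ds" for c d cs ds
  proof -
    from that have "cs \<in> extensional (prime_to CHAR('k))" "ds \<in> extensional (prime_to CHAR('k))"
      and rep: "wrep \<alpha> T' (Witt x) (Witt c) (\<lambda>i. Witt (cs i))"
        "wrep \<alpha> T' (Witt x) (Witt d) (\<lambda>i. Witt (ds i))"
      by (simp_all add: represents_iff)
    \<comment> \<open>Uniqueness of the coefficients concerns only indices in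
      \<open>prime_to\<close>; extensionality settles the others.\<close>
    then show ?thesis
      using wrep_unique[OF \<alpha> T rep] by (auto intro: extensionalityI)
  qed
  have ex: "\<exists>c cs. represents CHAR('k) \<alpha> T' x c cs"
  proof -
    obtain c C where rep: "wrep \<alpha> T' (Witt x) c C" using wrep_exists[OF \<alpha> T] .
    \<comment> \<open>Restriction makes the family extensional without changing any partial
      sum.\<close>
    define cs where "cs = restrict (\<lambda>i. wnth (C i)) (prime_to CHAR('k))"
    have "wnull (\<lambda>i. Witt (cs i)) = wnull C"
      by (simp add: wnull_def cs_def)
    moreover have "wpartial T' (\<lambda>i. Witt (cs i)) M = wpartial T' C M" for M
      by (rule wpartial_cong) (simp add: cs_def)
    ultimately have "represents CHAR('k) \<alpha> T' x (wnth c) cs"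
      using rep by (simp add: represents_iff wrep_def wsums_def) (simp add: cs_def)
    then show ?thesis by blast
  qed
  have ex1: "\<exists>!(c, cs). represents CHAR('k) \<alpha> T' x c cs"
  proof -
    from ex obtain c cs where "represents CHAR('k) \<alpha> T' x c cs" by blast
    then show ?thesis
      by (intro ex1I[of _ "(c, cs)"]) (auto dest: unique)
  qed
  have i: "x \<in> range (wp CHAR('k))" if "\<forall>j. fls_val (x j) > 0"
    using positive_witt_range_wAS[of "Witt x"] range_wp_iff[OF pf, of x] that by simp
  have ii: "witt_cong CHAR('k) x (witt_const c \<otimes>\<^bsub>witt_ring CHAR('k)\<^esub> witt_const (teich \<alpha>))"
    if rep: "represents CHAR('k) \<alpha> T' x c cs" and int: "\<forall>j. fls_val (x j) \<ge> 0" for c cs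
  proof -
    obtain d where d: "wfrob d = d" "Witt x - wconst d * wconst (wteich \<alpha>) \<in> range wAS"
      using integral_witt_decomp[OF \<alpha>, of "Witt x"] int by (auto simp: nonneg)
    have "Witt c = d"
      using wrep_unique(1)[OF \<alpha> T _ wrep_const[OF d]] rep by (auto simp: represents_iff)
    with d(2) show ?thesis
      using witt_cong_iff[OF pf] witt_ring_mult[OF pf] by (simp add: witt_const_eq wteich_def)
  qed
  have iii: "(\<exists>i\<in>prime_to CHAR('k). witt_val (cs i) = enat j) \<and>
      (\<forall>i\<in>prime_to CHAR('k). enat j \<le> witt_val (cs i))"
    if rep: "represents CHAR('k) \<alpha> T' x c cs" and neg: "fls_val (x j) < 0"
      and min: "\<forall>l<j. \<not> fls_val (x l) < 0" and ndvd: "\<not> int CHAR('k) dvd fls_subdegree (x j)"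
    for c cs j
  proof -
    have "fls_subdegree (x j) < 0"
      using neg nonneg[of "x j"] by (simp add: not_le[symmetric])
    moreover have "fls_subdegree (x l) \<ge> 0" if "l < j" for l
      using min that nonneg[of "x l"] by (simp add: not_less)
    ultimately have *: "\<forall>i\<in>prime_to CHAR('k). wlow j (Witt (cs i))"
      "\<exists>i\<in>prime_to CHAR('k). cs i j \<noteq> 0"
      using wrep_min_valuation[OF \<alpha> T, of "Witt x" "Witt c" "\<lambda>i. Witt (cs i)" j] rep ndvd
      by (auto simp: represents_iff)
    then have le: "\<forall>i\<in>prime_to CHAR('k). enat j \<le> witt_val (cs i)"
      by (simp add: wlow_def enat_le_witt_val)
    moreover obtain i where i: "i \<in> prime_to CHAR('k)" "cs i j \<noteq> 0" using *(2) by blast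
    then have "\<not> enat (Suc j) \<le> witt_val (cs i)"
      by (auto simp: enat_le_witt_val)
    with le i(1) have "witt_val (cs i) = enat j"
      by (metis Suc_ile_eq order_le_imp_less_or_eq)
    ultimately show ?thesis using i(1) by blast
  qed
  show ?thesis
    unfolding assms(1)[symmetric] using ex1 i ii iii by blast
qed

end
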